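(* Let $d,n,m\in\mathbb{N}$, let $(a_{ij})\in\mathbb{Z}^{n\times m}$ be such that for each $i\in\{1,\ldots,n\}$ the integers $a_{i1},\ldots,a_{im}$ are relatively prime, and let $\alpha_1,\ldots,\alpha_n\in\mathbb{R}$ satisfy $\sum_{i=1}^n\alpha_i=0$. Suppose that for all independent $\mathbb{Z}^d$-valued random variables $U_1,\ldots,U_m$, $$\sum_{i=1}^n \alpha_i H\Big(\sum_{j=1}^m a_{ij}U_j\Big)\le 0 .$$ Then for all independent $\mathbb{R}^d$-valued continuous random variables $X_1,\ldots,X_m$, $$\sum_{i=1}^n \alpha_i h\Big(\sum_{j=1}^m a_{ij}X_j\Big)\le 0 .$$
   Context: $H(U)=\sum_u P(U=u)\log\frac{1}{P(U=u)}$ is the Shannon entropy of a discrete random variable; $h(X)=\int f_X\log\frac1{f_X}$ is the differential entropy of a random vector with density $f_X$ (w.r.t. Lebesgue measure). "Continuous" means having a distribution absolutely continuous w.r.t. Lebesgue measure. Standing assumption: all (Shannon and differential) entropies appearing are assumed to exist and be finite. *)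

theory Defs
  imports "HOL-Probability.Probability"
begin

definition pmass :: "'a measure \<Rightarrow> ('a \<Rightarrow> 'b) \<Rightarrow> 'b \<Rightarrow> real" where
  "pmass M U u = measure M {\<omega> \<in> space M. U \<omega> = u}"

text \<open>Shannon entropy H(U) = sum over u of P(U=u) log (1 / P(U=u)) (natural logarithm;
  terms with P(U=u) = 0 contribute 0).\<close>
definition shannon_entropy :: "'a measure \<Rightarrow> ('a \<Rightarrow> 'b) \<Rightarrow> real" where
  "shannon_entropy M U = (\<Sum>\<^sub>\<infinity>u. pmass M U u * ln (1 / pmass M U u))"

definition finite_shannon_entropy :: "'a measure \<Rightarrow> ('a \<Rightarrow> 'b) \<Rightarrow> bool" where
  "finite_shannon_entropy M U \<longleftrightarrow> (\<lambda>u. pmass M U u * ln (1 / pmass M U u)) summable_on UNIV"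

definition lebesgue_density :: "'a measure \<Rightarrow> ('a \<Rightarrow> 'b::euclidean_space) \<Rightarrow> 'b \<Rightarrow> real" where
  "lebesgue_density M X = (\<lambda>x. enn2real (RN_deriv lborel (distr M lborel X) x))"

definition continuous_rv :: "'a measure \<Rightarrow> ('a \<Rightarrow> 'b::euclidean_space) \<Rightarrow> bool" where
  "continuous_rv M X \<longleftrightarrow> absolutely_continuous lborel (distr M lborel X)"

definition differential_entropy :: "'a measure \<Rightarrow> ('a \<Rightarrow> 'b::euclidean_space) \<Rightarrow> real" where
  "differential_entropy M X =
     (\<integral>x. lebesgue_density M X x * ln (1 / lebesgue_density M X x) \<partial>lborel)"

definition finite_differential_entropy :: "'a measure \<Rightarrow> ('a \<Rightarrow> 'b::euclidean_space) \<Rightarrow> bool" where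
  "finite_differential_entropy M X \<longleftrightarrow>
     continuous_rv M X \<and>
     integrable lborel (\<lambda>x. lebesgue_density M X x * ln (1 / lebesgue_density M X x))"

end

theory Submission
  imports Defs
begin

text \<open>
  Let \<open>f\<close> be the density of \<open>Y = \<Sum> a\<^sub>j X\<^sub>j\<close>. After conditioning all \<open>X\<^sub>j\<close> to lie in large sets on which
  \<open>X\<^sub>j\<close> and its density are bounded, the density of \<open>Y\<close> is at most \<open>2 f\<close> and close to \<open>f\<close> in L1, so
  dominated convergence reduces the claim to bounded \<open>X\<^sub>j\<close> with bounded densities.

  Put \<open>V\<^sub>k = \<Sum> a\<^sub>j \<lfloor>k X\<^sub>j\<rfloor>\<close> and let \<open>g\<^sub>k\<close> be the density that is constant on the cells of the lattice
  of mesh \<open>1/k\<close> and gives them the masses of \<open>V\<^sub>k\<close>; its differential entropy is \<open>H(V\<^sub>k) - d ln k\<close>. Since the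
  weights \<open>\<alpha>\<^sub>i\<close> sum to zero, it suffices that \<open>g\<^sub>k\<close>, which is uniformly bounded with bounded support,
  tends to \<open>f\<close> in L1.

  Adding \<open>a\<^sub>j e\<close> to \<open>V\<^sub>k\<close> amounts to translating \<open>X\<^sub>j\<close> by \<open>e/k\<close>, which by continuity of translation in L1
  hardly changes the distribution. As the \<open>a\<^sub>j\<close> are relatively prime, the law of \<open>V\<^sub>k\<close> is therefore
  asymptotically invariant under every fixed integer shift; so is that of \<open>Z\<^sub>k = \<lfloor>k Y\<rfloor>\<close>. Because \<open>Z\<^sub>k - V\<^sub>k\<close>
  is bounded, averaging over a large cube of shifts shows that the two laws merge in total
  variation, and the cell averages of \<open>f\<close>, which are given by \<open>Z\<^sub>k\<close>, tend to \<open>f\<close> in L1.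
\<close>

section \<open>Translations in L1\<close>

lemma
  fixes f :: "'a::euclidean_space \<Rightarrow> real"
  shows integral_translate: "f \<in> borel_measurable borel \<Longrightarrow> (\<integral>x. f (x + t) \<partial>lborel) = (\<integral>x. f x \<partial>lborel)"
    and integrable_translate: "integrable lborel f \<Longrightarrow> integrable lborel (\<lambda>x. f (x + t))"
proof -
  show "(\<integral>x. f (x + t) \<partial>lborel) = (\<integral>x. f x \<partial>lborel)" if "f \<in> borel_measurable borel"
    by (subst (2) lborel_distr_plus[of t, symmetric])
      (use that in \<open>simp add: integral_distr add.commute\<close>)
  show "integrable lborel (\<lambda>x. f (x + t))" if f: "integrable lborel f"
  proof -
    have "integrable (distr lborel borel ((+) t)) f"
      using f by (simp add: lborel_distr_plus)
    then show ?thesis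
      using f by (subst (asm) integrable_distr_eq) (auto simp: add.commute)
  qed
qed

text \<open>For indicators the distance is \<open>2 * measure lborel U\<close> minus twice the
  integral of the product of \<open>indicator U\<close> and its translate. Openness makes that
  product converge to \<open>1\<close> at every point of \<open>U\<close>. Off \<open>U\<close> it
  vanishes, so the boundary, which may have positive measure, does no harm.\<close>

lemma integral_open_translate_tendsto:
  fixes U :: "'a::euclidean_space set"
  assumes U: "open U" "emeasure lborel U < \<infinity>" and t: "t \<longlonglongrightarrow> 0"
  shows "(\<lambda>k. \<integral>x. \<bar>indicator U (x + t k) - indicator U x\<bar> \<partial>lborel) \<longlonglongrightarrow> (0::real)"
proof -
  have Us[measurable]: "U \<in> sets borel" using U by simp
  have int: "integrable lborel (indicator U :: 'a \<Rightarrow> real)"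
    using U by (simp add: integrable_indicator_iff)
  have int': "integrable lborel (\<lambda>x. indicator U (x + t k) * indicator U x :: real)" for k
    by (rule Bochner_Integration.integrable_bound[OF int]) (auto split: split_indicator)
  have eq: "(\<integral>x. \<bar>indicator U (x + t k) - indicator U x\<bar> \<partial>lborel)
      = 2 * measure lborel U - 2 * (\<integral>x. indicator U (x + t k) * indicator U x \<partial>lborel)" for k
  proof -
    have "(\<integral>x. \<bar>indicator U (x + t k) - indicator U x\<bar> \<partial>lborel)
      = (\<integral>x. indicator U (x + t k) + indicator U x - 2 * (indicator U (x + t k) * indicator U x) \<partial>lborel :: real)"
      by (intro Bochner_Integration.integral_cong) (auto split: split_indicator)
    also have "\<dots> = (\<integral>x. indicator U (x + t k) \<partial>lborel) + (\<integral>x. indicator U x \<partial>lborel)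
        - 2 * (\<integral>x. indicator U (x + t k) * indicator U x \<partial>lborel)"
      using int integrable_translate[OF int, of "t k"] int'[of k] by simp
    also have "(\<integral>x. indicator U (x + t k) \<partial>lborel :: real) = (\<integral>x. indicator U x \<partial>lborel)"
      by (intro integral_translate) auto
    finally show ?thesis by simp
  qed
  have "(\<lambda>k. \<integral>x. indicator U (x + t k) * indicator U x \<partial>lborel :: real) \<longlonglongrightarrow> (\<integral>x. indicator U x \<partial>lborel)"
  proof (rule integral_dominated_convergence[where w = "indicator U"])
    show "AE x in lborel. (\<lambda>k. indicator U (x + t k) * indicator U x :: real) \<longlonglongrightarrow> indicator U x"
    proof (intro AE_I2)
      fix x :: 'a
      show "(\<lambda>k. indicator U (x + t k) * indicator U x :: real) \<longlonglongrightarrow> indicator U x"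
      proof (cases "x \<in> U")
        case True
        have "(\<lambda>k. x + t k) \<longlonglongrightarrow> x + 0" by (intro tendsto_intros t)
        then have "eventually (\<lambda>k. x + t k \<in> U) sequentially"
          using U(1) True by (auto simp: tendsto_def)
        then have "eventually (\<lambda>k. indicator U (x + t k) * indicator U x = (indicator U x :: real)) sequentially"
          by eventually_elim (use True in auto)
        then show ?thesis by (rule tendsto_eventually)
      qed auto
    qed
  qed (use int in \<open>auto split: split_indicator\<close>)
  from tendsto_diff[OF tendsto_const[of "2 * measure lborel U"] tendsto_mult[OF tendsto_const[of 2] this]]
  show ?thesis unfolding eq by simp
qed

text \<open>The property is closed under L1 limits: by translation invariance of Lebesgue measure,
  replacing \<open>f\<close> by \<open>g\<close> costs their L1 distance only twice, whatever the
  translation.\<close>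

lemma translate_tendsto_L1_approx:
  fixes f :: "'a::euclidean_space \<Rightarrow> real"
  assumes f: "integrable lborel f"
    and approx: "\<And>e. e > 0 \<Longrightarrow> \<exists>g. integrable lborel g \<and> (\<integral>x. \<bar>f x - g x\<bar> \<partial>lborel) < e \<and>
        (\<lambda>k. \<integral>x. \<bar>g (x + t k) - g x\<bar> \<partial>lborel) \<longlonglongrightarrow> 0"
  shows "(\<lambda>k. \<integral>x. \<bar>f (x + t k) - f x\<bar> \<partial>lborel) \<longlonglongrightarrow> 0"
proof (rule LIMSEQ_I)
  fix e :: real assume "e > 0"
  then obtain g where g: "integrable lborel g" "(\<integral>x. \<bar>f x - g x\<bar> \<partial>lborel) < e / 3"
    "(\<lambda>k. \<integral>x. \<bar>g (x + t k) - g x\<bar> \<partial>lborel) \<longlonglongrightarrow> 0"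
    using approx[of "e/3"] by auto
  from LIMSEQ_D[OF g(3), of "e/3"] \<open>e > 0\<close> obtain N where
    N: "\<And>k. k \<ge> N \<Longrightarrow> (\<integral>x. \<bar>g (x + t k) - g x\<bar> \<partial>lborel) < e / 3" by force
  note [measurable] = borel_measurable_integrable[OF f] borel_measurable_integrable[OF g(1)]
  note ints = f g(1) integrable_translate[OF f] integrable_translate[OF g(1)]
  show "\<exists>N. \<forall>k\<ge>N. norm ((\<integral>x. \<bar>f (x + t k) - f x\<bar> \<partial>lborel) - 0) < e"
  proof (intro exI allI impI)
    fix k assume "k \<ge> N"
    have "(\<integral>x. \<bar>f (x + t k) - f x\<bar> \<partial>lborel) \<le>
      (\<integral>x. \<bar>f (x + t k) - g (x + t k)\<bar> + \<bar>g (x + t k) - g x\<bar> + \<bar>f x - g x\<bar> \<partial>lborel)"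
      by (intro integral_mono) (auto intro!: ints Bochner_Integration.integrable_diff Bochner_Integration.integrable_add integrable_abs)
    also have "\<dots> = (\<integral>x. \<bar>f (x + t k) - g (x + t k)\<bar> \<partial>lborel) +
        (\<integral>x. \<bar>g (x + t k) - g x\<bar> \<partial>lborel) + (\<integral>x. \<bar>f x - g x\<bar> \<partial>lborel)"
      by (simp add: ints)
    also have "(\<integral>x. \<bar>f (x + t k) - g (x + t k)\<bar> \<partial>lborel) = (\<integral>x. \<bar>f x - g x\<bar> \<partial>lborel)"
      using integral_translate[of "\<lambda>x. \<bar>f x - g x\<bar>" "t k"] by simp
    finally show "norm ((\<integral>x. \<bar>f (x + t k) - f x\<bar> \<partial>lborel) - 0) < e"
      using g(2) N[OF \<open>k \<ge> N\<close>] by simp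
  qed
qed

text \<open>Continuity of translation in L1, by induction over integrable functions. A measurable
  set is approximated from outside by an open one, sums follow from the triangle inequality, and
  dominated limits from closedness under L1 limits.\<close>

lemma translate_tendsto_L1:
  fixes f :: "'a::euclidean_space \<Rightarrow> real"
  assumes f: "integrable lborel f" and t: "t \<longlonglongrightarrow> 0"
  shows "(\<lambda>k. \<integral>x. \<bar>f (x + t k) - f x\<bar> \<partial>lborel) \<longlonglongrightarrow> 0"
  using f
proof (induction f rule: integrable_induct)
  case (base A c)
  then have A[measurable]: "A \<in> sets borel" by simp
  have iA: "integrable lborel (indicator A :: 'a \<Rightarrow> real)"
    using base by (simp add: integrable_indicator_iff)
  have *: "(\<lambda>k. \<integral>x. \<bar>indicator A (x + t k) - indicator A x\<bar> \<partial>lborel) \<longlonglongrightarrow> (0::real)"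
  proof (rule translate_tendsto_L1_approx[OF iA])
    fix e :: real assume "e > 0"
    obtain U where U: "open U" "A \<subseteq> U" "emeasure lborel (U - A) < ennreal e"
      using outer_regular_lborel[OF A \<open>e > 0\<close>] by auto
    have Us[measurable]: "U \<in> sets borel" using U by simp
    have "emeasure lborel U \<le> emeasure lborel A + emeasure lborel (U - A)"
      using U by (subst plus_emeasure) (auto intro!: emeasure_mono)
    also have "\<dots> < \<infinity>" using base U(3) by (simp add: order.strict_trans[OF U(3)])
    finally have fU: "emeasure lborel U < \<infinity>" .
    have "(\<integral>x. \<bar>indicator A x - indicator U x\<bar> \<partial>lborel) = (\<integral>x. indicator (U - A) x \<partial>lborel :: real)"
      using U(2) by (intro Bochner_Integration.integral_cong) (auto split: split_indicator)
    also have "\<dots> < e"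
    proof -
      have "emeasure lborel (U - A) = ennreal (measure lborel (U - A))"
        using U(3) by (intro emeasure_eq_ennreal_measure) auto
      then show ?thesis using U(3) by (simp add: ennreal_less_iff)
    qed
    finally show "\<exists>g. integrable lborel g \<and> (\<integral>x. \<bar>indicator A x - g x\<bar> \<partial>lborel) < e \<and>
        (\<lambda>k. \<integral>x. \<bar>g (x + t k) - g x\<bar> \<partial>lborel) \<longlonglongrightarrow> 0"
      using integral_open_translate_tendsto[OF U(1) fU t] fU
      by (intro exI[of _ "indicator U"]) (auto simp: integrable_indicator_iff)
  qed
  have "(\<integral>x. \<bar>indicator A (x + t k) *\<^sub>R c - indicator A x *\<^sub>R c\<bar> \<partial>lborel)
     = \<bar>c\<bar> * (\<integral>x. \<bar>indicator A (x + t k) - indicator A x\<bar> \<partial>lborel)" for k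
    by (subst integral_mult_right_zero[symmetric], intro Bochner_Integration.integral_cong)
      (auto split: split_indicator)
  then show ?case using tendsto_mult[OF tendsto_const[of "\<bar>c\<bar>"] *] by simp
next
  case (add f g)
  note ints = add(1,2) integrable_translate[OF add(1)] integrable_translate[OF add(2)]
  show ?case
  proof (rule tendsto_sandwich[OF _ _ tendsto_const])
    show "(\<lambda>k. (\<integral>x. \<bar>f (x + t k) - f x\<bar> \<partial>lborel) + (\<integral>x. \<bar>g (x + t k) - g x\<bar> \<partial>lborel)) \<longlonglongrightarrow> 0"
      using tendsto_add[OF add.IH] by simp
    show "\<forall>\<^sub>F k in sequentially. (\<integral>x. \<bar>f (x + t k) + g (x + t k) - (f x + g x)\<bar> \<partial>lborel)
       \<le> (\<integral>x. \<bar>f (x + t k) - f x\<bar> \<partial>lborel) + (\<integral>x. \<bar>g (x + t k) - g x\<bar> \<partial>lborel)"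
      by (intro always_eventually allI, subst Bochner_Integration.integral_add[symmetric])
        (auto intro!: integral_mono ints Bochner_Integration.integrable_diff Bochner_Integration.integrable_add integrable_abs)
  qed simp
next
  case (lim f s)
  note [measurable] = borel_measurable_integrable[OF lim(1)] borel_measurable_integrable[OF lim(4)]
  have "(\<lambda>i. \<integral>x. \<bar>f x - s i x\<bar> \<partial>lborel) \<longlonglongrightarrow> integral\<^sup>L lborel (\<lambda>x::'a. 0)"
  \<comment> \<open>The induction rule provides \<open>norm (s i x) \<le> 2 * norm (f x)\<close>;
    adding \<open>norm (f x)\<close> itself gives the factor \<open>3\<close>.\<close>
  proof (rule integral_dominated_convergence[where w = "\<lambda>x. 3 * norm (f x)"])
    show "AE x in lborel. (\<lambda>i. \<bar>f x - s i x\<bar>) \<longlonglongrightarrow> 0"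
    proof (intro AE_I2)
      fix x
      have "(\<lambda>i. \<bar>f x - s i x\<bar>) \<longlonglongrightarrow> \<bar>f x - f x\<bar>"
        by (intro tendsto_intros lim(2)) simp
      then show "(\<lambda>i. \<bar>f x - s i x\<bar>) \<longlonglongrightarrow> 0" by simp
    qed
    show "AE x in lborel. norm \<bar>f x - s i x\<bar> \<le> 3 * norm (f x)" for i
      using lim(3)[of _ i] by (intro AE_I2) (simp add: abs_if split: if_splits, smt)
  qed (use lim in auto)
  then have *: "(\<lambda>i. \<integral>x. \<bar>f x - s i x\<bar> \<partial>lborel) \<longlonglongrightarrow> 0" by simp
  show ?case
  proof (rule translate_tendsto_L1_approx[OF lim(4)])
    fix e :: real assume "e > 0"
    from LIMSEQ_D[OF * this] obtain i where "(\<integral>x. \<bar>f x - s i x\<bar> \<partial>lborel) < e" by fastforce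
    then show "\<exists>g. integrable lborel g \<and> (\<integral>x. \<bar>f x - g x\<bar> \<partial>lborel) < e \<and>
        (\<lambda>k. \<integral>x. \<bar>g (x + t k) - g x\<bar> \<partial>lborel) \<longlonglongrightarrow> 0"
      using lim by blast
  qed
qed

section \<open>The entropy integrand\<close>

text \<open>Since \<open>t * ln (1 / t)\<close> is not monotone, an upper bound on a density does
  not bound its integrand directly. Splitting off \<open>t * ln (s / t)\<close>, which lies between
  \<open>0\<close> and \<open>s - t\<close>, repairs this at the price of the extra
  \<open>s\<close>. The result supplies the majorants for dominated convergence.\<close>

lemma abs_entropy_integrand_le:
  fixes s t :: real
  assumes "0 \<le> t" "t \<le> s"
  shows "\<bar>t * ln (1 / t)\<bar> \<le> \<bar>s * ln (1 / s)\<bar> + s"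
proof (cases "t = 0")
  case True then show ?thesis using assms by simp
next
  case False
  then have t: "t > 0" "s > 0" using assms by auto
  have "ln (s / t) \<le> s / t - 1" using t by (intro ln_le_minus_one) simp
  then have 1: "t * ln (s / t) \<le> s - t" using t by (simp add: field_simps)
  have 2: "0 \<le> t * ln (s / t)" using t assms by (intro mult_nonneg_nonneg ln_ge_zero) auto
  have "t * ln (1 / t) = t * ln (1 / s) + t * ln (s / t)"
    using t by (simp add: ln_div algebra_simps)
  moreover have "\<bar>t * ln (1 / s)\<bar> \<le> \<bar>s * ln (1 / s)\<bar>"
    using assms by (simp add: abs_mult mult_right_mono)
  ultimately show ?thesis using 1 2 t by linarith
qed

text \<open>Only the endpoint \<open>0\<close> needs an argument: \<open>ln y \<le> y - 1\<close>
  with \<open>y = 1 / sqrt t\<close> squeezes the function between \<open>0\<close> and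
  \<open>2 * sqrt t\<close>.\<close>

lemma continuous_on_entropy_integrand: "continuous_on {0..} (\<lambda>t::real. t * ln (1 / t))"
proof (rule continuous_on_eq_continuous_within[THEN iffD2], rule ballI)
  fix x :: real assume "x \<in> {0..}"
  show "continuous (at x within {0..}) (\<lambda>t. t * ln (1 / t))"
  proof (cases "x = 0")
    case False
    then have "isCont (\<lambda>t. t * ln (1 / t)) x"
      using \<open>x \<in> {0..}\<close> by (intro continuous_intros) auto
    then show ?thesis by (rule continuous_at_imp_continuous_at_within)
  next
    case True
    have "((\<lambda>t::real. t * ln (1 / t)) \<longlongrightarrow> 0) (at_right 0)"
    proof (rule tendsto_sandwich)
      show "\<forall>\<^sub>F t::real in at_right 0. 0 \<le> t * ln (1 / t)"
        by (intro eventually_at_rightI[of 0 1]) (auto intro!: mult_nonneg_nonneg)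
      show "\<forall>\<^sub>F t::real in at_right 0. t * ln (1 / t) \<le> 2 * sqrt t"
      proof (intro eventually_at_rightI[of 0 1])
        fix t :: real assume "t \<in> {0<..<1}"
        then have t: "t > 0" by auto
        have "ln (1 / t) = 2 * ln (1 / sqrt t)"
          using t by (simp add: ln_div ln_sqrt)
        also have "\<dots> \<le> 2 * (1 / sqrt t)"
          using ln_le_minus_one[of "1 / sqrt t"] t by simp
        finally have "t * ln (1 / t) \<le> t * (2 * (1 / sqrt t))"
          using t by (intro mult_left_mono) auto
        also have "\<dots> = 2 * sqrt t" using t by (simp add: field_simps)
        finally show "t * ln (1 / t) \<le> 2 * sqrt t" .
      qed simp
      show "((\<lambda>t::real. 2 * sqrt t) \<longlongrightarrow> 0) (at_right 0)"
        by (auto intro!: tendsto_eq_intros)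
    qed simp
    then show ?thesis using True
      by (simp add: continuous_within at_within_Ici_at_right)
  qed
qed

text \<open>L1 convergence yields almost everywhere convergence only along subsequences; this
  criterion brings the conclusion back to the full sequence.\<close>

lemma LIMSEQ_subseqI:
  fixes x :: "nat \<Rightarrow> 'a::metric_space"
  assumes "\<And>r :: nat \<Rightarrow> nat. strict_mono r \<Longrightarrow> \<exists>s :: nat \<Rightarrow> nat. strict_mono s \<and> (\<lambda>k. x (r (s k))) \<longlonglongrightarrow> l"
  shows "x \<longlonglongrightarrow> l"
proof (rule ccontr)
  assume "\<not> x \<longlonglongrightarrow> l"
  then obtain e where e: "e > 0" "\<not> eventually (\<lambda>k. dist (x k) l < e) sequentially"
    by (auto simp: tendsto_iff)
  then have "infinite {k. \<not> dist (x k) l < e}"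
    by (simp add: cofinite_eq_sequentially[symmetric] eventually_cofinite)
  from infinite_enumerate[OF this] obtain r :: "nat \<Rightarrow> nat" where
    r: "strict_mono r" "\<And>k. r k \<in> {k. \<not> dist (x k) l < e}" by blast
  from assms[OF r(1)] obtain s where "(\<lambda>k. x (r (s k))) \<longlonglongrightarrow> l" by auto
  then have "eventually (\<lambda>k. dist (x (r (s k))) l < e) sequentially"
    using e(1) by (auto simp: tendsto_iff)
  with r(2) show False by (auto simp: eventually_sequentially)
qed

text \<open>Along a further subsequence \<open>u\<close> tends to \<open>v\<close> almost
  everywhere; continuity of the integrand on the closed half line carries this over, and dominated
  convergence with majorant \<open>w\<close> applies.\<close>

lemma integral_entropy_tendsto:
  fixes u :: "nat \<Rightarrow> 'b \<Rightarrow> real"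
  assumes u: "\<And>k. integrable N (u k)" "integrable N v"
    and nonneg: "\<And>k x. 0 \<le> u k x" "\<And>x. 0 \<le> v x"
    and L1: "(\<lambda>k. \<integral>x. \<bar>u k x - v x\<bar> \<partial>N) \<longlonglongrightarrow> 0"
    and dom: "integrable N w" "\<And>k. AE x in N. \<bar>u k x * ln (1 / u k x)\<bar> \<le> w x"
  shows "(\<lambda>k. \<integral>x. u k x * ln (1 / u k x) \<partial>N) \<longlonglongrightarrow> (\<integral>x. v x * ln (1 / v x) \<partial>N)"
proof (rule LIMSEQ_subseqI)
  fix r :: "nat \<Rightarrow> nat" assume r: "strict_mono r"
  note [measurable] = borel_measurable_integrable[OF u(1)] borel_measurable_integrable[OF u(2)]
  have "\<exists>s :: nat \<Rightarrow> nat. strict_mono s \<and> (AE x in N. (\<lambda>n. u (r (s n)) x - v x) \<longlonglongrightarrow> 0)"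
  proof -
    have "(\<lambda>k. \<integral>x. norm (u (r k) x - v x) \<partial>N) \<longlonglongrightarrow> 0"
      using LIMSEQ_subseq_LIMSEQ[OF L1 r] by (simp add: o_def)
    from tendsto_L1_AE_subseq[OF _ this] u show ?thesis by auto
  qed
  then obtain s :: "nat \<Rightarrow> nat" where s: "strict_mono s" "AE x in N. (\<lambda>n. u (r (s n)) x - v x) \<longlonglongrightarrow> 0" by auto
  have "(\<lambda>k. \<integral>x. u (r (s k)) x * ln (1 / u (r (s k)) x) \<partial>N) \<longlonglongrightarrow> (\<integral>x. v x * ln (1 / v x) \<partial>N)"
  proof (rule integral_dominated_convergence[OF _ _ dom(1)])
    show "AE x in N. (\<lambda>k. u (r (s k)) x * ln (1 / u (r (s k)) x)) \<longlonglongrightarrow> v x * ln (1 / v x)"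
      using s(2)
    proof eventually_elim
      case (elim x)
      have "(\<lambda>k. u (r (s k)) x) \<longlonglongrightarrow> v x" using elim by (simp add: LIM_zero_iff)
      from continuous_on_tendsto_compose[OF continuous_on_entropy_integrand this] nonneg
      show ?case by auto
    qed
  qed (use dom(2) in auto)
  with s(1) show "\<exists>s :: nat \<Rightarrow> nat. strict_mono s \<and>
    (\<lambda>k. \<integral>x. u (r (s k)) x * ln (1 / u (r (s k)) x) \<partial>N) \<longlonglongrightarrow> (\<integral>x. v x * ln (1 / v x) \<partial>N)" by blast
qed

section \<open>Discretisation\<close>

definition lattice_floor :: "real \<Rightarrow> real ^ 'd \<Rightarrow> int ^ 'd" where
  "lattice_floor r x = (\<chi> i. \<lfloor>r * x $ i\<rfloor>)"

lemma lattice_floor_eq_iff: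
  "lattice_floor r x = v \<longleftrightarrow> (\<forall>i. of_int (v $ i) \<le> r * x $ i \<and> r * x $ i < of_int (v $ i) + 1)"
  by (simp add: lattice_floor_def vec_eq_iff floor_eq_iff)

lemma measurable_lattice_floor[measurable]:
  "lattice_floor r \<in> borel \<rightarrow>\<^sub>M count_space (UNIV :: (int ^ 'd) set)"
proof (subst measurable_count_space_eq_countable[OF countableI_type], intro conjI ballI)
  fix v :: "int ^ 'd"
  have "{x :: real ^ 'd. \<forall>i. of_int (v $ i) \<le> r * x $ i \<and> r * x $ i < of_int (v $ i) + 1} \<in> sets borel"
    by measurable
  then show "lattice_floor r -` {v} \<inter> space borel \<in> sets borel"
    by (simp add: vimage_def lattice_floor_eq_iff)
qed simp

text \<open>The source of all shift invariance below: an integer shift of the quantised value is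
  exactly a translation of the vector by a distance of order \<open>1 / r\<close>.\<close>

lemma lattice_floor_add:
  "r > 0 \<Longrightarrow> lattice_floor r (x + (1 / r) *\<^sub>R (\<chi> i. of_int (e $ i))) = lattice_floor r x + e"
  by (simp add: lattice_floor_def vec_eq_iff algebra_simps)

text \<open>The cell is half-open, so it is squeezed between an open and a closed box of the same
  volume.\<close>

lemma emeasure_lattice_cell:
  fixes v :: "int ^ 'd"
  assumes r: "r > 0"
  shows "emeasure lborel {x. lattice_floor r x = v} = ennreal ((1 / r) ^ CARD('d))"
proof -
  define l :: "real ^ 'd" where "l = (\<chi> i. of_int (v $ i) / r)"
  define u :: "real ^ 'd" where "u = (\<chi> i. (of_int (v $ i) + 1) / r)"
  have lu: "(u - l) \<bullet> b = 1 / r" if "b \<in> Basis" for b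
    using that by (auto simp: Basis_vec_def inner_axis u_def l_def add_divide_distrib)
  then have le: "l \<bullet> b \<le> u \<bullet> b" if "b \<in> Basis" for b
    using that r by (smt (verit) inner_diff_left zero_less_divide_1_iff)
  have prod: "(\<Prod>b\<in>Basis. (u - l) \<bullet> b) = (1 / r) ^ CARD('d)"
    using lu by simp
  have 1: "box l u \<subseteq> {x. lattice_floor r x = v}"
    using r by (auto simp: mem_box_cart lattice_floor_eq_iff l_def u_def field_simps less_imp_le)
  have 2: "{x. lattice_floor r x = v} \<subseteq> cbox l u"
    using r by (auto simp: mem_box_cart lattice_floor_eq_iff l_def u_def field_simps less_imp_le)
  have [measurable]: "{x :: real ^ 'd. lattice_floor r x = v} \<in> sets borel"
    using measurable_sets[OF measurable_lattice_floor, of "{v}" r] by (simp add: vimage_def)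
  show ?thesis
  proof (rule antisym)
    show "emeasure lborel {x. lattice_floor r x = v} \<le> ennreal ((1 / r) ^ CARD('d))"
      using emeasure_mono[OF 2, of lborel] le prod by simp
    show "ennreal ((1 / r) ^ CARD('d)) \<le> emeasure lborel {x. lattice_floor r x = v}"
      using emeasure_mono[OF 1, of lborel] le prod by simp
  qed
qed

lemma measure_lattice_cell:
  fixes v :: "int ^ 'd"
  shows "r > 0 \<Longrightarrow> measure lborel {x. lattice_floor r x = v} = (1 / r) ^ CARD('d)"
  by (simp add: measure_def emeasure_lattice_cell)

text \<open>Finite support makes the integrand a finite combination of indicators of cells, each of
  volume \<open>(1 / r) ^ CARD('d)\<close>. This turns integrals of piecewise constant functions
  into sums over lattice points.\<close>

lemma
  fixes h :: "int ^ 'd \<Rightarrow> real"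
  assumes r: "r > 0" and S: "finite S" "\<And>v. v \<notin> S \<Longrightarrow> h v = 0"
  shows integral_lattice_floor: "(\<integral>y. h (lattice_floor r y) \<partial>lborel) = (1 / r) ^ CARD('d) * (\<Sum>v\<in>S. h v)"
    and integrable_lattice_floor: "integrable lborel (\<lambda>y. h (lattice_floor r y))"
proof -
  have [measurable]: "{x :: real ^ 'd. lattice_floor r x = v} \<in> sets borel" for v
    using measurable_sets[OF measurable_lattice_floor, of "{v}" r] by (simp add: vimage_def)
  have *: "h (lattice_floor r y) = (\<Sum>v\<in>S. h v * indicator {x. lattice_floor r x = v} y)" for y
    using S by (cases "lattice_floor r y \<in> S") (auto simp: indicator_def if_distrib sum.delta cong: if_cong)
  have i: "integrable lborel (\<lambda>y. h v * indicator {x. lattice_floor r x = v} y)" for v :: "int ^ 'd"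
    using r by (auto simp: integrable_indicator_iff emeasure_lattice_cell)
  show "integrable lborel (\<lambda>y. h (lattice_floor r y))"
    unfolding * using i by simp
  show "(\<integral>y. h (lattice_floor r y) \<partial>lborel) = (1 / r) ^ CARD('d) * (\<Sum>v\<in>S. h v)"
    unfolding * using i r
    by (subst Bochner_Integration.integral_sum)
      (auto simp: measure_lattice_cell sum_distrib_right mult.commute)
qed

section \<open>Averages over lattice cells and their convergence in L1\<close>

text \<open>For \<open>r > 0\<close> this is the conditional expectation of \<open>f\<close> given
  the partition into cells: the prefactor is the reciprocal of the volume of a cell.\<close>

definition cell_average :: "real \<Rightarrow> (real ^ 'd \<Rightarrow> real) \<Rightarrow> real ^ 'd \<Rightarrow> real" where
  "cell_average r f y = r ^ CARD('d) * (\<integral>x. f x * indicator {x. lattice_floor r x = lattice_floor r y} x \<partial>lborel)"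

lemma measurable_cell_average[measurable]:
  fixes f :: "real ^ 'd \<Rightarrow> real"
  shows "cell_average r f \<in> borel_measurable borel"
proof -
  have "cell_average r f = (\<lambda>v. r ^ CARD('d) * (\<integral>x. f x * indicator {x. lattice_floor r x = v} x \<partial>lborel)) \<circ> lattice_floor r"
    by (simp add: fun_eq_iff cell_average_def)
  then show ?thesis
    by (simp add: measurable_comp[OF measurable_lattice_floor])
qed

lemma nn_integral_translate:
  fixes f :: "'a::euclidean_space \<Rightarrow> ennreal"
  assumes "f \<in> borel_measurable borel"
  shows "(\<integral>\<^sup>+x. f (t + x) \<partial>lborel) = (\<integral>\<^sup>+x. f x \<partial>lborel)"
  by (subst (2) lborel_distr_plus[of t, symmetric]) (use assms in \<open>simp add: nn_integral_distr\<close>)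

text \<open>The difference at \<open>y\<close> is at most the average of
  \<open>\<bar>f x - f y\<bar>\<close> over the cell of \<open>y\<close>, and every such
  \<open>x\<close> is \<open>y + t\<close> with \<open>t\<close> in a cube of side
  \<open>2 / r\<close>. Exchanging the integrals leaves L1 distances of translates;
  \<open>2 ^ CARD('d)\<close> is the volume of that cube divided by the volume of a cell. The
  nonnegative integral is used because integrability of the average is itself deduced from this
  bound.\<close>

lemma cell_average_diff_le:
  fixes f :: "real ^ 'd \<Rightarrow> real"
  assumes r: "r > 0" and f: "integrable lborel f"
    and e: "\<And>t. (\<And>i. \<bar>t $ i\<bar> \<le> 1 / r) \<Longrightarrow> (\<integral>x. \<bar>f (x + t) - f x\<bar> \<partial>lborel) \<le> e"
  shows "(\<integral>\<^sup>+y. \<bar>cell_average r f y - f y\<bar> \<partial>lborel) \<le> ennreal (2 ^ CARD('d) * e)"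
proof -
  note [measurable] = borel_measurable_integrable[OF f]
  define B :: "(real ^ 'd) set" where "B = cbox (\<chi> i. - (1 / r)) (\<chi> i. 1 / r)"
  have B[measurable]: "B \<in> sets borel" by (simp add: B_def)
  have mB: "emeasure lborel B = ennreal ((2 / r) ^ CARD('d))"
  proof -
    have 1: "((\<chi> i. 1 / r) - (\<chi> i. - (1 / r))) \<bullet> b = 2 / r" if "b \<in> Basis" for b :: "real ^ 'd"
      using that by (auto simp: Basis_vec_def inner_axis)
    then have "(\<chi> i. - (1 / r)) \<bullet> b \<le> (\<chi> i. 1 / r) \<bullet> b" if "b \<in> Basis" for b :: "real ^ 'd"
      using that r by (smt (verit) inner_diff_left zero_less_divide_iff)
    then show ?thesis unfolding B_def using 1 by simp
  qed
  have e0: "0 \<le> e"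
    using e[of 0] r by (simp)
  have cell[measurable]: "{x :: real ^ 'd. lattice_floor r x = v} \<in> sets borel" for v
    using measurable_sets[OF measurable_lattice_floor, of "{v}" r] by (simp add: vimage_def)
  let ?c = "ennreal (r ^ CARD('d))"
  have *: "ennreal \<bar>cell_average r f y - f y\<bar> \<le>
      (\<integral>\<^sup>+t. ?c * (indicator B t * ennreal \<bar>f (y + t) - f y\<bar>) \<partial>lborel)" for y
  proof -
    let ?I = "indicator {x. lattice_floor r x = lattice_floor r y} :: real ^ 'd \<Rightarrow> real"
    have i: "integrable lborel ?I"
      using r by (simp add: integrable_indicator_iff emeasure_lattice_cell)
    have i1: "integrable lborel (\<lambda>x. f x * ?I x)"
      by (rule Bochner_Integration.integrable_bound[OF f]) (auto split: split_indicator)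
    have i2: "integrable lborel (\<lambda>x. (f x - f y) * ?I x)"
      unfolding left_diff_distrib by (intro Bochner_Integration.integrable_diff i1) (use i in simp)
    have "f y = r ^ CARD('d) * (\<integral>x. f y * ?I x \<partial>lborel)"
      using r by (simp add: measure_lattice_cell power_divide)
    then have "cell_average r f y - f y = r ^ CARD('d) * ((\<integral>x. f x * ?I x \<partial>lborel) - (\<integral>x. f y * ?I x \<partial>lborel))"
      unfolding cell_average_def right_diff_distrib by simp
    also have "\<dots> = r ^ CARD('d) * (\<integral>x. (f x - f y) * ?I x \<partial>lborel)"
      using i i1 by (subst Bochner_Integration.integral_diff[symmetric]) (auto simp: left_diff_distrib)
    finally have "ennreal \<bar>cell_average r f y - f y\<bar> = ?c * ennreal \<bar>\<integral>x. (f x - f y) * ?I x \<partial>lborel\<bar>"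
      using r by (simp add: abs_mult ennreal_mult)
    also have "\<dots> \<le> ?c * (\<integral>\<^sup>+x. ennreal \<bar>(f x - f y) * ?I x\<bar> \<partial>lborel)"
      using integral_norm_bound_ennreal[OF i2] by (intro mult_left_mono) auto
    also have "\<dots> = (\<integral>\<^sup>+x. ?c * ennreal \<bar>(f x - f y) * ?I x\<bar> \<partial>lborel)"
      by (intro nn_integral_cmult[symmetric]) measurable
    also have "\<dots> = (\<integral>\<^sup>+t. ?c * ennreal \<bar>(f (y + t) - f y) * ?I (y + t)\<bar> \<partial>lborel)"
      by (intro nn_integral_translate[symmetric]) measurable
    also have "\<dots> \<le> (\<integral>\<^sup>+t. ?c * (indicator B t * ennreal \<bar>f (y + t) - f y\<bar>) \<partial>lborel)"
    proof (intro nn_integral_mono mult_left_mono)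
      fix t
      have "t \<in> B" if "lattice_floor r (y + t) = lattice_floor r y"
      proof -
        have "\<bar>t $ i\<bar> \<le> 1 / r" for i
        proof -
          have "\<lfloor>r * (y $ i + t $ i)\<rfloor> = \<lfloor>r * y $ i\<rfloor>"
            using that by (simp add: lattice_floor_def vec_eq_iff)
          then have "\<bar>r * (y $ i + t $ i) - r * y $ i\<bar> \<le> 1" by linarith
          then have "\<bar>r * t $ i\<bar> \<le> 1" by (simp add: algebra_simps)
          then show ?thesis using r by (simp add: abs_mult field_simps)
        qed
        then show ?thesis unfolding B_def mem_box_cart by (auto simp: abs_le_iff minus_le_iff)
      qed
      then show "ennreal \<bar>(f (y + t) - f y) * ?I (y + t)\<bar> \<le> indicator B t * ennreal \<bar>f (y + t) - f y\<bar>"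
        by (auto split: split_indicator)
    qed simp
    finally show ?thesis .
  qed
  have "(\<integral>\<^sup>+y. \<bar>cell_average r f y - f y\<bar> \<partial>lborel) \<le>
      (\<integral>\<^sup>+y. (\<integral>\<^sup>+t. ?c * (indicator B t * ennreal \<bar>f (y + t) - f y\<bar>) \<partial>lborel) \<partial>lborel)"
    using * by (intro nn_integral_mono) auto
  also have "\<dots> = (\<integral>\<^sup>+t. (\<integral>\<^sup>+y. ?c * (indicator B t * ennreal \<bar>f (y + t) - f y\<bar>) \<partial>lborel) \<partial>lborel)"
    by (intro lborel_pair.Fubini') measurable
  also have "\<dots> = (\<integral>\<^sup>+t. ?c * (indicator B t * (\<integral>\<^sup>+y. ennreal \<bar>f (y + t) - f y\<bar> \<partial>lborel)) \<partial>lborel)"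
    by (intro nn_integral_cong) (simp add: nn_integral_cmult)
  also have "\<dots> \<le> (\<integral>\<^sup>+t. ?c * (indicator B t * ennreal e) \<partial>lborel)"
  proof (intro nn_integral_mono mult_left_mono[where c = ?c])
    fix t
    show "indicator B t * (\<integral>\<^sup>+y. ennreal \<bar>f (y + t) - f y\<bar> \<partial>lborel) \<le> indicator B t * ennreal e"
    proof (cases "t \<in> B")
      case True
      then have "\<bar>t $ i\<bar> \<le> 1 / r" for i
        unfolding B_def mem_box_cart by (auto simp: abs_le_iff minus_le_iff)
      from e[OF this] have "(\<integral>x. \<bar>f (x + t) - f x\<bar> \<partial>lborel) \<le> e" .
      moreover have "(\<integral>\<^sup>+y. ennreal \<bar>f (y + t) - f y\<bar> \<partial>lborel) = ennreal (\<integral>x. \<bar>f (x + t) - f x\<bar> \<partial>lborel)"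
        by (intro nn_integral_eq_integral) (auto intro!: f integrable_translate)
      ultimately show ?thesis using True by (simp add: ennreal_leI)
    qed simp
  qed simp
  also have "\<dots> = ?c * (ennreal ((2 / r) ^ CARD('d)) * ennreal e)"
    by (simp add: nn_integral_cmult nn_integral_multc mB)
  also have "\<dots> = ennreal (2 ^ CARD('d) * e)"
    using r e0 by (simp add: ennreal_mult[symmetric] power_divide)
  finally show ?thesis .
qed

text \<open>The preceding bound is applied with the crude modulus
  \<open>2 * (\<integral>x. \<bar>f x\<bar> \<partial>lborel)\<close>, valid for every
  translation.\<close>

lemma integrable_cell_average:
  fixes f :: "real ^ 'd \<Rightarrow> real"
  assumes r: "r > 0" and f: "integrable lborel f"
  shows "integrable lborel (cell_average r f)"
proof -
  note [measurable] = borel_measurable_integrable[OF f]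
  have "(\<integral>\<^sup>+y. \<bar>cell_average r f y - f y\<bar> \<partial>lborel) \<le> ennreal (2 ^ CARD('d) * (2 * (\<integral>x. \<bar>f x\<bar> \<partial>lborel)))"
  proof (rule cell_average_diff_le[OF r f])
    fix t :: "real ^ 'd"
    have "(\<integral>x. \<bar>f (x + t) - f x\<bar> \<partial>lborel) \<le> (\<integral>x. \<bar>f (x + t)\<bar> + \<bar>f x\<bar> \<partial>lborel)"
      by (intro integral_mono) (auto intro!: f integrable_translate)
    also have "\<dots> = 2 * (\<integral>x. \<bar>f x\<bar> \<partial>lborel)"
      using f integrable_translate[OF f, of t] integral_translate[of "\<lambda>x. \<bar>f x\<bar>" t] by simp
    finally show "(\<integral>x. \<bar>f (x + t) - f x\<bar> \<partial>lborel) \<le> 2 * (\<integral>x. \<bar>f x\<bar> \<partial>lborel)" .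
  qed
  then have "integrable lborel (\<lambda>y. cell_average r f y - f y)"
    by (intro integrableI_bounded) (auto simp: le_less_trans[OF _ ennreal_less_top])
  from Bochner_Integration.integrable_add[OF this f] show ?thesis by simp
qed

text \<open>A vector with all coordinates at most \<open>1 / r\<close> in absolute value has norm at
  most \<open>CARD('d) / r\<close>, so for fine lattices all translations in the cell bound are
  short at once.\<close>

lemma cell_average_tendsto_L1:
  fixes f :: "real ^ 'd \<Rightarrow> real"
  assumes f: "integrable lborel f" and r: "\<And>k. r k > 0" "filterlim r at_top sequentially"
  shows "(\<lambda>k. \<integral>y. \<bar>cell_average (r k) f y - f y\<bar> \<partial>lborel) \<longlonglongrightarrow> 0"
proof (rule LIMSEQ_I)
  fix e :: real assume "e > 0"
  define \<tau> where "\<tau> t = (\<integral>x. \<bar>f (x + t) - f x\<bar> \<partial>lborel)" for t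
  define e' where "e' = e / (2 * 2 ^ CARD('d))"
  have "e' > 0" using \<open>e > 0\<close> by (simp add: e'_def)
  \<comment> \<open>Sequential continuity is upgraded to a single radius \<open>d\<close>, because
    the cell bound needs the estimate uniformly over a cube of translations.\<close>
  have "isCont \<tau> 0"
    unfolding continuous_at_sequentially o_def
    using translate_tendsto_L1[OF f] by (auto simp: \<tau>_def)
  then obtain d where d: "d > 0" "\<And>t. norm t < d \<Longrightarrow> \<bar>\<tau> t\<bar> < e'"
    using \<open>e' > 0\<close> unfolding continuous_at_eps_delta by (fastforce simp: \<tau>_def dist_norm)
  from filterlim_at_top_dense[THEN iffD1, OF r(2)]
  have "eventually (\<lambda>k. r k > real CARD('d) / d) sequentially" by blast
  then obtain N where N: "\<And>k. k \<ge> N \<Longrightarrow> r k > real CARD('d) / d" by (auto simp: eventually_sequentially)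
  show "\<exists>N. \<forall>k\<ge>N. norm ((\<integral>y. \<bar>cell_average (r k) f y - f y\<bar> \<partial>lborel) - 0) < e"
  proof (intro exI allI impI)
    fix k assume "k \<ge> N"
    have "(\<integral>\<^sup>+y. \<bar>cell_average (r k) f y - f y\<bar> \<partial>lborel) \<le> ennreal (2 ^ CARD('d) * e')"
    proof (rule cell_average_diff_le[OF r(1) f])
      fix t :: "real ^ 'd" assume t: "\<And>i. \<bar>t $ i\<bar> \<le> 1 / r k"
      have "norm t \<le> (\<Sum>i\<in>UNIV. \<bar>t $ i\<bar>)" by (rule norm_le_l1_cart)
      also have "\<dots> \<le> real CARD('d) * (1 / r k)" using t by (intro sum_bounded_above) auto
      also have "\<dots> < d" using N[OF \<open>k \<ge> N\<close>] r(1)[of k] d(1) by (simp add: field_simps)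
      finally show "(\<integral>x. \<bar>f (x + t) - f x\<bar> \<partial>lborel) \<le> e'" using d(2)[of t] by (simp add: \<tau>_def)
    qed
    also have "(\<integral>\<^sup>+y. \<bar>cell_average (r k) f y - f y\<bar> \<partial>lborel) = ennreal (\<integral>y. \<bar>cell_average (r k) f y - f y\<bar> \<partial>lborel)"
      by (intro nn_integral_eq_integral) (auto intro!: f integrable_cell_average r)
    finally have "(\<integral>y. \<bar>cell_average (r k) f y - f y\<bar> \<partial>lborel) \<le> 2 ^ CARD('d) * e'"
      using \<open>e' > 0\<close> by (simp add: ennreal_le_iff)
    also have "\<dots> < e" using \<open>e > 0\<close> by (simp add: e'_def)
    finally show "norm ((\<integral>y. \<bar>cell_average (r k) f y - f y\<bar> \<partial>lborel) - 0) < e" by simp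
  qed
qed

section \<open>Asymptotic shift invariance\<close>

text \<open>The test functions may change with \<open>k\<close>. For measurable \<open>W\<close> the
  condition therefore says that the total variation distance between the laws of
  \<open>W k + s\<close> and \<open>W k\<close> tends to zero.\<close>

definition asymp_shift_invariant :: "'a measure \<Rightarrow> (nat \<Rightarrow> 'a \<Rightarrow> int ^ 'd) \<Rightarrow> int ^ 'd \<Rightarrow> bool" where
  "asymp_shift_invariant M W s \<longleftrightarrow>
    (\<forall>\<psi> :: nat \<Rightarrow> int ^ 'd \<Rightarrow> real. (\<forall>k v. \<bar>\<psi> k v\<bar> \<le> 1) \<longrightarrow>
      (\<lambda>k. (\<integral>\<omega>. \<psi> k (W k \<omega> + s) \<partial>M) - (\<integral>\<omega>. \<psi> k (W k \<omega>) \<partial>M)) \<longlonglongrightarrow> 0)"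

lemma asymp_shift_invariant_0: "asymp_shift_invariant M W 0"
  by (simp add: asymp_shift_invariant_def)

text \<open>A translated family of test functions is again admissible. Together with the lemmas on
  \<open>0\<close> and on negatives this makes the invariant shifts a subgroup.\<close>

lemma asymp_shift_invariant_add:
  fixes W :: "nat \<Rightarrow> 'a \<Rightarrow> int ^ 'd"
  assumes "asymp_shift_invariant M W s" "asymp_shift_invariant M W t"
  shows "asymp_shift_invariant M W (s + t)"
  unfolding asymp_shift_invariant_def
proof (intro allI impI)
  fix \<psi> :: "nat \<Rightarrow> int ^ 'd \<Rightarrow> real" assume \<psi>: "\<forall>k v. \<bar>\<psi> k v\<bar> \<le> 1"
  have "(\<lambda>k. (\<integral>\<omega>. \<psi> k (W k \<omega> + s + t) \<partial>M) - (\<integral>\<omega>. \<psi> k (W k \<omega> + t) \<partial>M)) \<longlonglongrightarrow> 0"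
    using assms(1)[unfolded asymp_shift_invariant_def, rule_format, of "\<lambda>k v. \<psi> k (v + t)"] \<psi> by simp
  from tendsto_add[OF this assms(2)[unfolded asymp_shift_invariant_def, rule_format, of \<psi>]] \<psi>
  show "(\<lambda>k. (\<integral>\<omega>. \<psi> k (W k \<omega> + (s + t)) \<partial>M) - (\<integral>\<omega>. \<psi> k (W k \<omega>) \<partial>M)) \<longlonglongrightarrow> 0"
    by (simp add: add.assoc)
qed

lemma asymp_shift_invariant_uminus:
  fixes W :: "nat \<Rightarrow> 'a \<Rightarrow> int ^ 'd"
  assumes "asymp_shift_invariant M W s"
  shows "asymp_shift_invariant M W (- s)"
  unfolding asymp_shift_invariant_def
proof (intro allI impI)
  fix \<psi> :: "nat \<Rightarrow> int ^ 'd \<Rightarrow> real" assume \<psi>: "\<forall>k v. \<bar>\<psi> k v\<bar> \<le> 1"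
  have "(\<lambda>k. (\<integral>\<omega>. \<psi> k (W k \<omega>) \<partial>M) - (\<integral>\<omega>. \<psi> k (W k \<omega> - s) \<partial>M)) \<longlonglongrightarrow> 0"
    using assms(1)[unfolded asymp_shift_invariant_def, rule_format, of "\<lambda>k v. \<psi> k (v - s)"] \<psi> by simp
  from tendsto_minus[OF this]
  show "(\<lambda>k. (\<integral>\<omega>. \<psi> k (W k \<omega> + - s) \<partial>M) - (\<integral>\<omega>. \<psi> k (W k \<omega>) \<partial>M)) \<longlonglongrightarrow> 0"
    by simp
qed

lemma asymp_shift_invariant_smult:
  fixes W :: "nat \<Rightarrow> 'a \<Rightarrow> int ^ 'd"
  assumes "asymp_shift_invariant M W s"
  shows "asymp_shift_invariant M W (c *s s)"
proof -
  have nat: "asymp_shift_invariant M W (int n *s s)" for n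
    by (induction n)
      (auto simp: vector_sadd_rdistrib intro!: asymp_shift_invariant_0 asymp_shift_invariant_add assms)
  show ?thesis
  proof (cases "c \<ge> 0")
    case True
    then show ?thesis using nat[of "nat c"] by simp
  next
    case False
    then show ?thesis using asymp_shift_invariant_uminus[OF nat[of "nat (- c)"]]
      by (simp add: vector_sneg_minus1 vector_smult_assoc)
  qed
qed

text \<open>Bezout: a subgroup containing \<open>c *s e\<close> for every \<open>c\<close> in
  \<open>A\<close> also contains \<open>Gcd A *s e\<close>. This is where relative primality turns
  shifts by multiples of the coefficients into arbitrary shifts.\<close>

lemma asymp_shift_invariant_all:
  fixes W :: "nat \<Rightarrow> 'a \<Rightarrow> int ^ 'd"
  assumes A: "finite A" "Gcd A = 1"
    and inv: "\<And>c e. c \<in> A \<Longrightarrow> asymp_shift_invariant M W (c *s e)"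
  shows "asymp_shift_invariant M W e"
proof -
  have "\<forall>e. asymp_shift_invariant M W (Gcd A *s e)"
    using A(1) inv
  proof (induction A)
    case empty
    then show ?case by (simp add: asymp_shift_invariant_0)
  next
    case (insert c A)
    obtain u v where uv: "u * c + v * Gcd A = gcd c (Gcd A)" using bezout_int by blast
    show ?case
    proof
      fix e
      have "asymp_shift_invariant M W (u *s (c *s e) + v *s (Gcd A *s e))"
        using insert
        by (intro asymp_shift_invariant_add asymp_shift_invariant_smult[of _ _ "c *s e"]
            asymp_shift_invariant_smult[of _ _ "Gcd A *s e"]) auto
      also have "u *s (c *s e) + v *s (Gcd A *s e) = Gcd (insert c A) *s e"
        by (simp add: vector_smult_assoc vector_sadd_rdistrib[symmetric] uv)
      finally show "asymp_shift_invariant M W (Gcd (insert c A) *s e)" .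
    qed
  qed
  then show ?thesis using A(2) by simp
qed

section \<open>Merging of two shift invariant laws at bounded distance\<close>

lemma
  fixes l u :: int
  shows card_int_cube: "card {s :: int ^ 'd. \<forall>i. l \<le> s $ i \<and> s $ i < u} = nat (u - l) ^ CARD('d)"
    and finite_int_cube: "finite {s :: int ^ 'd. \<forall>i. l \<le> s $ i \<and> s $ i < u}"
proof -
  have eq: "{s :: int ^ 'd. \<forall>i. l \<le> s $ i \<and> s $ i < u} = vec_lambda ` (UNIV \<rightarrow>\<^sub>E {l..<u})"
  proof (intro set_eqI iffI)
    fix s :: "int ^ 'd" assume "s \<in> {s. \<forall>i. l \<le> s $ i \<and> s $ i < u}"
    then show "s \<in> vec_lambda ` (UNIV \<rightarrow>\<^sub>E {l..<u})"
      by (intro image_eqI[of _ _ "\<lambda>i. s $ i"]) auto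
  qed (auto simp: PiE_iff)
  show "card {s :: int ^ 'd. \<forall>i. l \<le> s $ i \<and> s $ i < u} = nat (u - l) ^ CARD('d)"
    unfolding eq by (subst card_image) (auto intro!: injI simp: card_PiE vec_lambda_inject inj_on_def)
  show "finite {s :: int ^ 'd. \<forall>i. l \<le> s $ i \<and> s $ i < u}"
    unfolding eq by (intro finite_imageI finite_PiE) auto
qed

text \<open>The two translated cubes both contain the cube shrunk by \<open>C\<close> on each side.\<close>
lemma sum_cube_translate_le:
  fixes z v :: "int ^ 'd" and \<psi> :: "int ^ 'd \<Rightarrow> real" and C L :: nat
  assumes \<psi>: "\<And>v. \<bar>\<psi> v\<bar> \<le> 1" and C: "\<And>i. \<bar>z $ i - v $ i\<bar> \<le> int C" and L: "2 * C \<le> L"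
  defines "I \<equiv> {s :: int ^ 'd. \<forall>i. 0 \<le> s $ i \<and> s $ i < int L}"
  shows "\<bar>(\<Sum>s\<in>I. \<psi> (z + s)) - (\<Sum>s\<in>I. \<psi> (v + s))\<bar> \<le> 2 * (real L ^ CARD('d) - (real L - 2 * real C) ^ CARD('d))"
proof -
  \<comment> \<open>Chosen so that summing \<open>\<psi> (z + s)\<close> over \<open>I\<close> is
    the same as summing \<open>\<psi> (v + s)\<close> over \<open>A\<close>; the two sums then share
    the part over \<open>J\<close>.\<close>
  define A where "A = (\<lambda>s. s + (z - v)) ` I"
  define J where "J = {s :: int ^ 'd. \<forall>i. int C \<le> s $ i \<and> s $ i < int L - int C}"
  have fin: "finite I" "finite A" "finite J"
    unfolding A_def I_def J_def by (auto intro!: finite_int_cube)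
  have JI: "J \<subseteq> I"
  proof
    fix s assume s: "s \<in> J"
    have "0 \<le> s $ i \<and> s $ i < int L" for i
      using s unfolding J_def by (auto dest!: spec[of _ i])
    then show "s \<in> I" by (simp add: I_def)
  qed
  have JA: "J \<subseteq> A"
  proof
    fix s assume s: "s \<in> J"
    have "s - (z - v) \<in> I" unfolding I_def
    proof (intro CollectI allI)
      fix i
      show "0 \<le> (s - (z - v)) $ i \<and> (s - (z - v)) $ i < int L"
        using C[of i] s unfolding J_def by (auto dest!: spec[of _ i])
    qed
    then show "s \<in> A" unfolding A_def by (intro image_eqI[of _ _ "s - (z - v)"]) auto
  qed
  have cI: "card I = L ^ CARD('d)" unfolding I_def by (subst card_int_cube) simp
  have cA: "card A = L ^ CARD('d)" unfolding A_def cI[symmetric] by (intro card_image) (auto simp: inj_on_def)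
  have "nat (int L - int C - int C) = L - 2 * C" by arith
  then have cJ: "card J = (L - 2 * C) ^ CARD('d)" unfolding J_def by (subst card_int_cube) simp
  define D where "D = real L ^ CARD('d) - (real L - 2 * real C) ^ CARD('d)"
  have *: "\<bar>\<Sum>s\<in>K - J. \<psi> (v + s)\<bar> \<le> D"
    if "finite K" "J \<subseteq> K" "card K = L ^ CARD('d)" for K
  proof -
    have "\<bar>\<Sum>s\<in>K - J. \<psi> (v + s)\<bar> \<le> (\<Sum>s\<in>K - J. 1)"
      by (intro order_trans[OF sum_abs] sum_mono \<psi>)
    also have "\<dots> = real (card K) - real (card J)"
      using card_mono[OF that(1,2)] that fin by (simp add: card_Diff_subset of_nat_diff)
    finally show ?thesis using L by (simp add: D_def that cJ of_nat_diff)
  qed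
  have "(\<Sum>s\<in>I. \<psi> (z + s)) = (\<Sum>s\<in>A. \<psi> (v + s))"
    unfolding A_def by (subst sum.reindex) (auto simp: inj_on_def algebra_simps)
  moreover have "(\<Sum>s\<in>A. \<psi> (v + s)) = (\<Sum>s\<in>A - J. \<psi> (v + s)) + (\<Sum>s\<in>J. \<psi> (v + s))"
    by (rule sum.subset_diff[OF JA fin(2)])
  moreover have "(\<Sum>s\<in>I. \<psi> (v + s)) = (\<Sum>s\<in>I - J. \<psi> (v + s)) + (\<Sum>s\<in>J. \<psi> (v + s))"
    by (rule sum.subset_diff[OF JI fin(1)])
  ultimately show ?thesis
    using *[OF fin(1) JI cI] *[OF fin(2) JA cA] unfolding D_def[symmetric] by linarith
qed

lemma (in prob_space) integrable_bounded_count_space: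
  fixes \<psi> :: "'b \<Rightarrow> real"
  assumes [measurable]: "W \<in> M \<rightarrow>\<^sub>M count_space UNIV" and "\<And>v. \<bar>\<psi> v\<bar> \<le> c"
  shows "integrable M (\<lambda>\<omega>. \<psi> (W \<omega>))"
proof (rule integrable_const_bound[of _ c])
  show "(\<lambda>\<omega>. \<psi> (W \<omega>)) \<in> borel_measurable M"
    by (rule measurable_compose[OF assms(1)]) simp
qed (use assms in auto)

text \<open>Averaging both variables over a cube that is large compared with \<open>C\<close> changes neither
  distribution much, and makes the bounded difference invisible.\<close>
lemma (in prob_space) expectation_diff_tendsto_0:
  fixes V Z :: "nat \<Rightarrow> 'a \<Rightarrow> int ^ 'd" and \<psi> :: "nat \<Rightarrow> int ^ 'd \<Rightarrow> real"
  assumes V[measurable]: "\<And>k. V k \<in> M \<rightarrow>\<^sub>M count_space UNIV"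
    and Z[measurable]: "\<And>k. Z k \<in> M \<rightarrow>\<^sub>M count_space UNIV"
    and inv: "\<And>s. asymp_shift_invariant M V s" "\<And>s. asymp_shift_invariant M Z s"
    and C: "\<And>k \<omega> i. \<bar>Z k \<omega> $ i - V k \<omega> $ i\<bar> \<le> int C"
    and \<psi>: "\<And>k v. \<bar>\<psi> k v\<bar> \<le> 1"
  shows "(\<lambda>k. expectation (\<lambda>\<omega>. \<psi> k (Z k \<omega>)) - expectation (\<lambda>\<omega>. \<psi> k (V k \<omega>))) \<longlonglongrightarrow> 0"
proof (rule LIMSEQ_I)
  fix e :: real assume e: "e > 0"
  define n where "n = CARD('d)"
  \<comment> \<open>The cube size \<open>L\<close> is fixed before \<open>k\<close>: for large
    \<open>L\<close> the share of the cube lost by shrinking each side by \<open>C\<close> is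
    negligible. The finitely many shifts in the cube are then handled by letting \<open>k\<close>
    grow.\<close>
  have "(\<lambda>L. 2 * (1 - (1 - 2 * real C * (1 / real L)) ^ n)) \<longlonglongrightarrow> 2 * (1 - (1 - 2 * real C * 0) ^ n)"
    by (intro tendsto_intros lim_1_over_n)
  then have "eventually (\<lambda>L. 2 * (1 - (1 - 2 * real C * (1 / real L)) ^ n) < e / 3) sequentially"
    using e by (intro order_tendstoD) auto
  from eventually_conj[OF this eventually_gt_at_top[of "2 * C"]]
  obtain L where L: "2 * (1 - (1 - 2 * real C * (1 / real L)) ^ n) < e / 3" "2 * C < L"
    by (auto simp: eventually_sequentially)
  define I where "I = {s :: int ^ 'd. \<forall>i. 0 \<le> s $ i \<and> s $ i < int L}"
  define c where "c = real L ^ n"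
  have c: "c > 0" using L(2) by (simp add: c_def)
  have cI: "real (card I) = c" unfolding I_def by (subst card_int_cube) (simp add: c_def n_def)
  have lim: "(\<lambda>k. (\<Sum>s\<in>I. expectation (\<lambda>\<omega>. \<psi> k (W k \<omega> + s)) - expectation (\<lambda>\<omega>. \<psi> k (W k \<omega>)))) \<longlonglongrightarrow> 0"
    if "\<And>s. asymp_shift_invariant M W s" for W :: "nat \<Rightarrow> 'a \<Rightarrow> int ^ 'd"
    using that \<psi> unfolding asymp_shift_invariant_def by (intro tendsto_null_sum) auto
  have ce: "c * (e / 3) > 0" using c e by simp
  have ev: "eventually (\<lambda>k. \<bar>\<Sum>s\<in>I. expectation (\<lambda>\<omega>. \<psi> k (W k \<omega> + s)) - expectation (\<lambda>\<omega>. \<psi> k (W k \<omega>))\<bar> < c * (e / 3)) sequentially"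
    if "\<And>s. asymp_shift_invariant M W s" for W :: "nat \<Rightarrow> 'a \<Rightarrow> int ^ 'd"
    using order_tendstoD(2)[OF tendsto_rabs_zero[OF lim[OF that]] ce] .
  from eventually_conj[OF ev[OF inv(1)] ev[OF inv(2)]] obtain N where
    N: "\<And>k. k \<ge> N \<Longrightarrow> \<bar>\<Sum>s\<in>I. expectation (\<lambda>\<omega>. \<psi> k (V k \<omega> + s)) - expectation (\<lambda>\<omega>. \<psi> k (V k \<omega>))\<bar> < c * (e / 3)"
       "\<And>k. k \<ge> N \<Longrightarrow> \<bar>\<Sum>s\<in>I. expectation (\<lambda>\<omega>. \<psi> k (Z k \<omega> + s)) - expectation (\<lambda>\<omega>. \<psi> k (Z k \<omega>))\<bar> < c * (e / 3)"
    unfolding eventually_sequentially by blast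
  show "\<exists>N. \<forall>k\<ge>N. norm (expectation (\<lambda>\<omega>. \<psi> k (Z k \<omega>)) - expectation (\<lambda>\<omega>. \<psi> k (V k \<omega>)) - 0) < e"
  proof (intro exI allI impI)
    fix k assume k: "k \<ge> N"
    have int: "integrable M (\<lambda>\<omega>. \<psi> k (W \<omega> + s))" if "W \<in> M \<rightarrow>\<^sub>M count_space UNIV" for W s
      using \<psi> by (intro integrable_bounded_count_space[OF that, of "\<lambda>v. \<psi> k (v + s)" 1])
    have sumE: "(\<Sum>s\<in>I. expectation (\<lambda>\<omega>. \<psi> k (W \<omega> + s))) = expectation (\<lambda>\<omega>. \<Sum>s\<in>I. \<psi> k (W \<omega> + s))"
      if "W \<in> M \<rightarrow>\<^sub>M count_space UNIV" for W
      using int[OF that] by simp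
    have intS: "integrable M (\<lambda>\<omega>. \<Sum>s\<in>I. \<psi> k (W \<omega> + s))" if "W \<in> M \<rightarrow>\<^sub>M count_space UNIV" for W
      using int[OF that] by simp
    have "\<bar>expectation (\<lambda>\<omega>. \<Sum>s\<in>I. \<psi> k (Z k \<omega> + s)) - expectation (\<lambda>\<omega>. \<Sum>s\<in>I. \<psi> k (V k \<omega> + s))\<bar>
       = \<bar>expectation (\<lambda>\<omega>. (\<Sum>s\<in>I. \<psi> k (Z k \<omega> + s)) - (\<Sum>s\<in>I. \<psi> k (V k \<omega> + s)))\<bar>"
      using intS[OF V[of k]] intS[OF Z[of k]] by simp
    also have "\<dots> \<le> expectation (\<lambda>\<omega>. \<bar>(\<Sum>s\<in>I. \<psi> k (Z k \<omega> + s)) - (\<Sum>s\<in>I. \<psi> k (V k \<omega> + s))\<bar>)"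
      by (rule integral_abs_bound)
    also have "\<dots> \<le> expectation (\<lambda>\<omega>. 2 * (real L ^ n - (real L - 2 * real C) ^ n))"
      unfolding I_def n_def
      by (intro integral_mono integrable_abs Bochner_Integration.integrable_diff
          intS[unfolded I_def] sum_cube_translate_le \<psi> C V Z) (use L in auto)
    also have "\<dots> = 2 * (real L ^ n - (real L - 2 * real C) ^ n)" by (simp add: prob_space)
    also have "\<dots> = c * (2 * (1 - (1 - 2 * real C * (1 / real L)) ^ n))"
    proof -
      have "real L - 2 * real C = real L * (1 - 2 * real C * (1 / real L))"
        using L(2) by (simp add: field_simps)
      then have "(real L - 2 * real C) ^ n = c * (1 - 2 * real C * (1 / real L)) ^ n"
        unfolding c_def power_mult_distrib[symmetric] by (rule arg_cong)
      then show ?thesis unfolding c_def[symmetric] by (simp only: right_diff_distrib mult_1_right mult.left_commute)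
    qed
    also have "\<dots> < c * (e / 3)" using L(1) c by simp
    finally have mid: "\<bar>expectation (\<lambda>\<omega>. \<Sum>s\<in>I. \<psi> k (Z k \<omega> + s)) - expectation (\<lambda>\<omega>. \<Sum>s\<in>I. \<psi> k (V k \<omega> + s))\<bar> < c * (e / 3)" .
    \<comment> \<open>Replacing a variable by its average over the cube of shifts costs less than
      \<open>e / 3\<close> for each of \<open>V\<close> and \<open>Z\<close>; the third such error,
      \<open>mid\<close>, compares the two averages.\<close>
    have *: "\<bar>expectation (\<lambda>\<omega>. \<Sum>s\<in>I. \<psi> k (W k \<omega> + s)) - c * expectation (\<lambda>\<omega>. \<psi> k (W k \<omega>))\<bar> < c * (e / 3)"
      if "\<bar>\<Sum>s\<in>I. expectation (\<lambda>\<omega>. \<psi> k (W k \<omega> + s)) - expectation (\<lambda>\<omega>. \<psi> k (W k \<omega>))\<bar> < c * (e / 3)"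
        "W k \<in> M \<rightarrow>\<^sub>M count_space UNIV" for W
      using that sumE[OF that(2)] by (simp add: sum_subtractf cI)
    have "c * \<bar>expectation (\<lambda>\<omega>. \<psi> k (Z k \<omega>)) - expectation (\<lambda>\<omega>. \<psi> k (V k \<omega>))\<bar>
      = \<bar>c * expectation (\<lambda>\<omega>. \<psi> k (Z k \<omega>)) - c * expectation (\<lambda>\<omega>. \<psi> k (V k \<omega>))\<bar>"
      using c by (simp add: abs_mult right_diff_distrib[symmetric])
    also have "\<dots> < c * e"
      using mid *[of V, OF N(1)[OF k] V] *[of Z, OF N(2)[OF k] Z] by linarith
    finally show "norm (expectation (\<lambda>\<omega>. \<psi> k (Z k \<omega>)) - expectation (\<lambda>\<omega>. \<psi> k (V k \<omega>)) - 0) < e"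
      using c by simp
  qed
qed

section \<open>Translating a density, and conditioning on an independent variable\<close>

text \<open>A substitution moves the translation from the test function to the density, after which
  \<open>\<psi>\<close> is bounded by \<open>1\<close>. The bound thus does not depend on
  \<open>\<psi>\<close>. It is written with \<open>x + - t\<close> to match the form of the
  translation lemmas.\<close>

lemma integral_translate_density_diff_le:
  fixes f \<psi> :: "'a::euclidean_space \<Rightarrow> real"
  assumes f: "integrable lborel f" and [measurable]: "\<psi> \<in> borel_measurable borel"
    and \<psi>: "\<And>x. \<bar>\<psi> x\<bar> \<le> 1"
  shows "\<bar>(\<integral>x. f x * \<psi> (x + t) \<partial>lborel) - (\<integral>x. f x * \<psi> x \<partial>lborel)\<bar> \<le> (\<integral>x. \<bar>f (x + - t) - f x\<bar> \<partial>lborel)"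
proof -
  note [measurable] = borel_measurable_integrable[OF f]
  have i: "integrable lborel (\<lambda>x. g x * \<psi> x)" if g: "integrable lborel g" for g
  proof (rule Bochner_Integration.integrable_bound[OF g])
    have "\<bar>g x\<bar> * \<bar>\<psi> x\<bar> \<le> \<bar>g x\<bar> * 1" for x using \<psi> by (intro mult_left_mono) auto
    then show "AE x in lborel. norm (g x * \<psi> x) \<le> norm (g x)" by (simp add: abs_mult)
  qed (use g in measurable)
  have f': "integrable lborel (\<lambda>x. f (x + - t))" by (rule integrable_translate[OF f])
  have "(\<integral>x. f x * \<psi> (x + t) \<partial>lborel) = (\<integral>x. f (x + - t) * \<psi> x \<partial>lborel)"
    using integral_translate[of "\<lambda>x. f x * \<psi> (x + t)" "- t"] by simp
  then have "(\<integral>x. f x * \<psi> (x + t) \<partial>lborel) - (\<integral>x. f x * \<psi> x \<partial>lborel) = (\<integral>x. (f (x + - t) - f x) * \<psi> x \<partial>lborel)"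
    using i[OF f] i[OF f'] by (simp add: left_diff_distrib)
  also have "\<bar>\<dots>\<bar> \<le> (\<integral>x. \<bar>(f (x + - t) - f x) * \<psi> x\<bar> \<partial>lborel)"
    by (rule integral_abs_bound)
  also have "\<dots> \<le> (\<integral>x. \<bar>f (x + - t) - f x\<bar> \<partial>lborel)"
  proof (rule integral_mono)
    have "\<bar>g\<bar> * \<bar>\<psi> x\<bar> \<le> \<bar>g\<bar> * 1" for g x using \<psi> by (intro mult_left_mono) auto
    then show "\<bar>(f (x + - t) - f x) * \<psi> x\<bar> \<le> \<bar>f (x + - t) - f x\<bar>" for x by (simp add: abs_mult)
  qed (use f f' i[of "\<lambda>x. f (x + - t) - f x"] in auto)
  finally show ?thesis .
qed

text \<open>Independence makes the joint law a product, so Fubini applies. Pulling both factors back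
  to \<open>M\<close> replaces the second variable by an independent copy, frozen in the inner
  expectation.\<close>

lemma (in prob_space) expectation_indep_pair:
  fixes \<psi> :: "'b \<Rightarrow> 'b \<Rightarrow> real"
  assumes ind: "indep_var S X T R"
    and \<psi>[measurable]: "(\<lambda>(x, y). \<psi> x y) \<in> borel_measurable (S \<Otimes>\<^sub>M T)" and b: "\<And>x y. \<bar>\<psi> x y\<bar> \<le> 1"
  shows "expectation (\<lambda>\<omega>. \<psi> (X \<omega>) (R \<omega>)) = expectation (\<lambda>\<omega>'. expectation (\<lambda>\<omega>. \<psi> (X \<omega>) (R \<omega>')))"
proof -
  have X[measurable]: "X \<in> M \<rightarrow>\<^sub>M S" and R[measurable]: "R \<in> M \<rightarrow>\<^sub>M T"
    using ind by (auto dest: indep_var_rv1 indep_var_rv2)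
  interpret X: prob_space "distr M S X" by (rule prob_space_distr) measurable
  interpret R: prob_space "distr M T R" by (rule prob_space_distr) measurable
  interpret P: pair_prob_space "distr M S X" "distr M T R" ..
  have eq: "distr M S X \<Otimes>\<^sub>M distr M T R = distr M (S \<Otimes>\<^sub>M T) (\<lambda>x. (X x, R x))"
    using ind by (simp add: indep_var_distribution_eq)
  have int: "integrable (distr M S X \<Otimes>\<^sub>M distr M T R) (\<lambda>(x, y). \<psi> x y)"
  proof (rule P.integrable_const_bound[of _ 1])
    show "(\<lambda>(x, y). \<psi> x y) \<in> borel_measurable (distr M S X \<Otimes>\<^sub>M distr M T R)"
      using \<psi> by (simp cong: measurable_cong_sets)
  qed (use b in auto)
  have "(\<integral>y. (\<integral>x. \<psi> x y \<partial>distr M S X) \<partial>distr M T R) = (\<integral>p. (case p of (x, y) \<Rightarrow> \<psi> x y) \<partial>(distr M S X \<Otimes>\<^sub>M distr M T R))"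
    by (rule P.integral_snd[OF int])
  also have "\<dots> = expectation (\<lambda>\<omega>. \<psi> (X \<omega>) (R \<omega>))"
    unfolding eq by (subst integral_distr) auto
  finally have "expectation (\<lambda>\<omega>. \<psi> (X \<omega>) (R \<omega>)) = (\<integral>y. (\<integral>x. \<psi> x y \<partial>distr M S X) \<partial>distr M T R)" ..
  also have "\<dots> = expectation (\<lambda>\<omega>'. \<integral>x. \<psi> x (R \<omega>') \<partial>distr M S X)"
  proof (subst integral_distr)
    have "(\<lambda>(y, x). \<psi> x y) \<in> borel_measurable (T \<Otimes>\<^sub>M S)"
      using measurable_compose[OF measurable_pair_swap' \<psi>] by (simp add: split_beta')
    then have "(\<lambda>(y, x). \<psi> x y) \<in> borel_measurable (T \<Otimes>\<^sub>M distr M S X)"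
      by (simp cong: measurable_cong_sets)
    then show "(\<lambda>y. \<integral>x. \<psi> x y \<partial>distr M S X) \<in> borel_measurable T"
      by (intro X.borel_measurable_lebesgue_integral)
  qed simp_all
  also have "\<dots> = expectation (\<lambda>\<omega>'. expectation (\<lambda>\<omega>. \<psi> (X \<omega>) (R \<omega>')))"
  proof (intro Bochner_Integration.integral_cong refl)
    fix \<omega>' assume "\<omega>' \<in> space M"
    then have [measurable]: "R \<omega>' \<in> space T" using R by (rule measurable_space[rotated])
    show "(\<integral>x. \<psi> x (R \<omega>') \<partial>distr M S X) = expectation (\<lambda>\<omega>. \<psi> (X \<omega>) (R \<omega>'))"
      by (intro integral_distr) measurable
  qed
  finally show ?thesis .
qed

section \<open>Densities\<close>

text \<open>The Radon-Nikodym derivative of a probability law is finite almost everywhere, so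
  passing from extended to real values by \<open>enn2real\<close> leaves the law unchanged.\<close>

lemma (in prob_space)
  fixes X :: "'a \<Rightarrow> 'b::euclidean_space"
  assumes X[measurable]: "X \<in> borel_measurable M" and cont: "continuous_rv M X"
  shows lebesgue_density_measurable: "lebesgue_density M X \<in> borel_measurable borel"
    and lebesgue_density_nonneg: "0 \<le> lebesgue_density M X x"
    and distr_lebesgue_density: "distr M lborel X = density lborel (\<lambda>x. ennreal (lebesgue_density M X x))"
    and integrable_lebesgue_density: "integrable lborel (lebesgue_density M X)"
proof -
  show m[measurable]: "lebesgue_density M X \<in> borel_measurable borel"
    using borel_measurable_RN_deriv[of lborel "distr M lborel X"] by (simp add: lebesgue_density_def)
  show "0 \<le> lebesgue_density M X x" for x
    by (simp add: lebesgue_density_def)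
  interpret D: prob_space "distr M lborel X" by (rule prob_space_distr) simp
  have ac: "absolutely_continuous lborel (distr M lborel X)"
    using cont by (simp add: continuous_rv_def)
  have "AE x in lborel. RN_deriv lborel (distr M lborel X) x \<noteq> \<infinity>"
    using ac by (intro sigma_finite_measure.RN_deriv_finite[OF sigma_finite_lborel] D.sigma_finite_measure_axioms) auto
  then have "density lborel (\<lambda>x. ennreal (lebesgue_density M X x)) = density lborel (RN_deriv lborel (distr M lborel X))"
    by (intro density_cong) (auto simp: lebesgue_density_def less_top)
  also have "\<dots> = distr M lborel X"
    using ac by (intro sigma_finite_measure.density_RN_deriv[OF sigma_finite_lborel]) auto
  finally show eq: "distr M lborel X = density lborel (\<lambda>x. ennreal (lebesgue_density M X x))" ..
  have "(\<integral>\<^sup>+x. ennreal (lebesgue_density M X x) \<partial>lborel) = emeasure (distr M lborel X) (space lborel)"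
    unfolding eq by (simp add: emeasure_density)
  also have "\<dots> = 1" using D.emeasure_space_1 by simp
  finally show "integrable lborel (lebesgue_density M X)"
    by (intro integrableI_nonneg) (auto simp: lebesgue_density_def)
qed

lemma (in prob_space) expectation_lebesgue_density:
  fixes X :: "'a \<Rightarrow> 'b::euclidean_space" and \<psi> :: "'b \<Rightarrow> real"
  assumes X[measurable]: "X \<in> borel_measurable M" and cont: "continuous_rv M X"
    and [measurable]: "\<psi> \<in> borel_measurable borel"
  shows "expectation (\<lambda>\<omega>. \<psi> (X \<omega>)) = (\<integral>x. lebesgue_density M X x * \<psi> x \<partial>lborel)"
proof -
  note [measurable] = lebesgue_density_measurable[OF X cont]
  have "expectation (\<lambda>\<omega>. \<psi> (X \<omega>)) = (\<integral>x. \<psi> x \<partial>distr M lborel X)"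
    by (subst integral_distr) auto
  also have "\<dots> = (\<integral>x. lebesgue_density M X x * \<psi> x \<partial>lborel)"
    unfolding distr_lebesgue_density[OF X cont]
    by (subst integral_density) (auto simp: lebesgue_density_nonneg[OF X cont])
  finally show ?thesis .
qed

lemma (in prob_space) expectation_translate_diff_le:
  fixes X :: "'a \<Rightarrow> 'b::euclidean_space" and \<psi> :: "'b \<Rightarrow> real"
  assumes X[measurable]: "X \<in> borel_measurable M" and cont: "continuous_rv M X"
    and [measurable]: "\<psi> \<in> borel_measurable borel" and \<psi>: "\<And>x. \<bar>\<psi> x\<bar> \<le> 1"
  shows "\<bar>expectation (\<lambda>\<omega>. \<psi> (X \<omega> + t)) - expectation (\<lambda>\<omega>. \<psi> (X \<omega>))\<bar>
    \<le> (\<integral>x. \<bar>lebesgue_density M X (x + - t) - lebesgue_density M X x\<bar> \<partial>lborel)"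
  using integral_translate_density_diff_le[OF integrable_lebesgue_density[OF X cont], of \<psi> t] \<psi>
    expectation_lebesgue_density[OF X cont, of \<psi>]
    expectation_lebesgue_density[OF X cont, of "\<lambda>x. \<psi> (x + t)"]
  by simp

text \<open>Countability of the value type allows the partial sum to be frozen at each of its values
  in turn.\<close>

lemma measurable_sum_count_space:
  fixes f :: "'i \<Rightarrow> 'a \<Rightarrow> 'b::{countable, comm_monoid_add}"
  assumes "\<And>j. j \<in> J \<Longrightarrow> f j \<in> N \<rightarrow>\<^sub>M count_space UNIV"
  shows "(\<lambda>\<omega>. \<Sum>j\<in>J. f j \<omega>) \<in> N \<rightarrow>\<^sub>M count_space UNIV"
  using assms
proof (induction J rule: infinite_finite_induct)
  case (insert j J)
  have "(\<lambda>\<omega>. f j \<omega> + (\<Sum>j\<in>J. f j \<omega>)) \<in> N \<rightarrow>\<^sub>M count_space UNIV"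
  proof (rule measurable_compose_countable[where g = "\<lambda>\<omega>. \<Sum>j\<in>J. f j \<omega>"])
    show "(\<lambda>\<omega>. f j \<omega> + i) \<in> N \<rightarrow>\<^sub>M count_space UNIV" for i
      by (rule measurable_compose[of "f j" N "count_space UNIV"]) (use insert in auto)
  qed (use insert in auto)
  then show ?case using insert by simp
qed auto

lemma (in prob_space) expectation_finite_support:
  fixes h :: "'b \<Rightarrow> real"
  assumes W[measurable]: "W \<in> M \<rightarrow>\<^sub>M count_space UNIV" and S: "finite S" "AE \<omega> in M. W \<omega> \<in> S"
  shows "expectation (\<lambda>\<omega>. h (W \<omega>)) = (\<Sum>v\<in>S. pmass M W v * h v)"
proof -
  have [measurable]: "{\<omega> \<in> space M. W \<omega> = v} \<in> sets M" for v
    using measurable_sets[OF W, of "{v}"] by (simp add: vimage_def Int_def conj_commute)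
  have [measurable]: "(\<lambda>\<omega>. h (W \<omega>)) \<in> borel_measurable M"
    by (rule measurable_compose[OF W]) simp
  have "expectation (\<lambda>\<omega>. h (W \<omega>)) = expectation (\<lambda>\<omega>. \<Sum>v\<in>S. h v * indicator {\<omega> \<in> space M. W \<omega> = v} \<omega>)"
  proof (intro integral_cong_AE)
    show "AE \<omega> in M. h (W \<omega>) = (\<Sum>v\<in>S. h v * indicator {\<omega> \<in> space M. W \<omega> = v} \<omega>)"
      using S(2) AE_space
      by eventually_elim (use S(1) in \<open>simp add: indicator_def if_distrib sum.delta' cong: if_cong\<close>)
  qed measurable
  also have "\<dots> = (\<Sum>v\<in>S. pmass M W v * h v)"
    by (subst Bochner_Integration.integral_sum)
      (auto simp: pmass_def mult.commute integrable_indicator_iff emeasure_eq_measure)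
  finally show ?thesis .
qed

section \<open>Quantised sums of bounded random vectors\<close>

text \<open>One row of coefficients is fixed. The constant \<open>C\<close> bounds the density of
  each \<open>X j\<close>, expressed as domination of its law by a multiple of Lebesgue measure, a
  form that is convenient to verify after conditioning.\<close>

locale quantized_sum = prob_space M for M :: "'a measure" +
  fixes m :: nat and a :: "nat \<Rightarrow> int" and X :: "nat \<Rightarrow> 'a \<Rightarrow> real ^ 'd" and B C :: real
  assumes gcd: "Gcd (a ` {..<m}) = 1"
    and indep: "indep_vars (\<lambda>_. borel) X {..<m}"
    and B: "0 \<le> B" "\<And>j. j < m \<Longrightarrow> AE \<omega> in M. norm (X j \<omega>) \<le> B"
    and C: "0 \<le> C" "\<And>j A. j < m \<Longrightarrow> A \<in> sets borel \<Longrightarrow>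
          emeasure M (X j -` A \<inter> space M) \<le> ennreal C * emeasure lborel A"
    and cont_sum: "continuous_rv M (\<lambda>\<omega>. \<Sum>j<m. real_of_int (a j) *\<^sub>R X j \<omega>)"
begin

definition Y :: "'a \<Rightarrow> real ^ 'd" where
  "Y \<omega> = (\<Sum>j<m. real_of_int (a j) *\<^sub>R X j \<omega>)"

text \<open>Here each vector is quantised before summation, which makes the discrete inequality
  applicable; \<open>Z\<close> quantises the sum itself. The successor keeps the scale positive at
  \<open>k = 0\<close>.\<close>

definition V :: "nat \<Rightarrow> 'a \<Rightarrow> int ^ 'd" where
  "V k \<omega> = (\<Sum>j<m. a j *s lattice_floor (real (Suc k)) (X j \<omega>))"

definition Z :: "nat \<Rightarrow> 'a \<Rightarrow> int ^ 'd" where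
  "Z k \<omega> = lattice_floor (real (Suc k)) (Y \<omega>)"

lemma X_measurable: "j < m \<Longrightarrow> X j \<in> borel_measurable M"
  using indep by (auto simp: indep_vars_def)

lemma Y_measurable[measurable]: "Y \<in> borel_measurable M"
  unfolding Y_def[abs_def] using X_measurable by (intro borel_measurable_sum) auto

lemma continuous_rv_Y: "continuous_rv M Y"
  using cont_sum by (simp add: Y_def[abs_def])

lemma continuous_rv_X: "j < m \<Longrightarrow> continuous_rv M (X j)"
  unfolding continuous_rv_def absolutely_continuous_def
proof (rule subsetI)
  fix N :: "(real ^ 'd) set" assume j: "j < m" and N: "N \<in> null_sets lborel"
  have [measurable]: "X j \<in> borel_measurable M" using X_measurable[OF j] .
  have "emeasure M (X j -` N \<inter> space M) = 0"
    using C(2)[OF j, of N] N by (auto simp: null_sets_def)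
  then show "N \<in> null_sets (distr M lborel (X j))"
    using N by (auto simp: null_sets_def emeasure_distr)
qed

lemma quantized_measurable:
  assumes "f \<in> N \<rightarrow>\<^sub>M (borel :: (real ^ 'd) measure)"
  shows "(\<lambda>\<omega>. c *s lattice_floor r (f \<omega>)) \<in> N \<rightarrow>\<^sub>M count_space UNIV"
  by (rule measurable_compose[OF measurable_compose[OF assms measurable_lattice_floor]]) simp

lemma V_measurable[measurable]: "V k \<in> M \<rightarrow>\<^sub>M count_space UNIV"
  unfolding V_def[abs_def] using X_measurable
  by (intro measurable_sum_count_space quantized_measurable) auto

lemma Z_measurable[measurable]: "Z k \<in> M \<rightarrow>\<^sub>M count_space UNIV"
  unfolding Z_def[abs_def] by measurable

text \<open>The part of \<open>V k\<close> that is independent of \<open>X j\<close>.\<close>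

definition R :: "nat \<Rightarrow> nat \<Rightarrow> 'a \<Rightarrow> int ^ 'd" where
  "R j k \<omega> = (\<Sum>i\<in>{..<m} - {j}. a i *s lattice_floor (real (Suc k)) (X i \<omega>))"

lemma V_split: "j < m \<Longrightarrow> V k \<omega> = a j *s lattice_floor (real (Suc k)) (X j \<omega>) + R j k \<omega>"
  unfolding V_def R_def by (subst sum.remove[of _ j]) auto

lemma R_measurable[measurable]: "R j k \<in> M \<rightarrow>\<^sub>M count_space UNIV"
  unfolding R_def[abs_def] using X_measurable
  by (intro measurable_sum_count_space quantized_measurable) auto

text \<open>\<open>X j\<close> and \<open>R j k\<close> depend on disjoint blocks of an independent
  family. Both blocks are taken as product spaces, the first with the single coordinate
  \<open>j\<close>. Joint measurability of \<open>g\<close> is reduced to that of its sections, as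
  \<open>R j k\<close> takes countably many values.\<close>

lemma expectation_split:
  fixes g :: "real ^ 'd \<Rightarrow> int ^ 'd \<Rightarrow> real"
  assumes j: "j < m" and g: "\<And>\<rho>. (\<lambda>x. g x \<rho>) \<in> borel_measurable borel" "\<And>x \<rho>. \<bar>g x \<rho>\<bar> \<le> 1"
  shows "expectation (\<lambda>\<omega>. g (X j \<omega>) (R j k \<omega>)) = expectation (\<lambda>\<omega>'. expectation (\<lambda>\<omega>. g (X j \<omega>) (R j k \<omega>')))"
proof -
  define \<rho> where "\<rho> y = (\<Sum>i\<in>{..<m} - {j}. a i *s lattice_floor (real (Suc k)) (y i))" for y :: "nat \<Rightarrow> real ^ 'd"
  let ?S = "PiM {j} (\<lambda>_. borel) :: (nat \<Rightarrow> real ^ 'd) measure"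
  let ?T = "PiM ({..<m} - {j}) (\<lambda>_. borel) :: (nat \<Rightarrow> real ^ 'd) measure"
  have ind: "indep_var ?S (\<lambda>\<omega>. \<lambda>i\<in>{j}. X i \<omega>) ?T (\<lambda>\<omega>. \<lambda>i\<in>{..<m} - {j}. X i \<omega>)"
    using j by (intro indep_var_restrict[OF indep]) auto
  have \<rho>: "\<rho> \<in> ?T \<rightarrow>\<^sub>M count_space UNIV"
    unfolding \<rho>_def by (intro measurable_sum_count_space quantized_measurable measurable_component_singleton)
  have \<rho>': "(\<lambda>p. \<rho> (snd p)) \<in> ?S \<Otimes>\<^sub>M ?T \<rightarrow>\<^sub>M count_space UNIV"
    by (rule measurable_compose[OF measurable_snd \<rho>])
  have "(\<lambda>p. g (fst p j) (\<rho> (snd p))) \<in> borel_measurable (?S \<Otimes>\<^sub>M ?T)"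
  proof (rule measurable_compose_countable[where g = "\<lambda>p. \<rho> (snd p)", OF _ \<rho>'])
    fix i
    have "(\<lambda>p. fst p j) \<in> ?S \<Otimes>\<^sub>M ?T \<rightarrow>\<^sub>M (borel :: (real ^ 'd) measure)"
      by (rule measurable_compose[OF measurable_fst]) (rule measurable_component_singleton, simp)
    from measurable_compose[OF this g(1)]
    show "(\<lambda>p. g (fst p j) i) \<in> borel_measurable (?S \<Otimes>\<^sub>M ?T)" .
  qed
  then have "expectation (\<lambda>\<omega>. g ((\<lambda>i\<in>{j}. X i \<omega>) j) (\<rho> (\<lambda>i\<in>{..<m} - {j}. X i \<omega>))) =
     expectation (\<lambda>\<omega>'. expectation (\<lambda>\<omega>. g ((\<lambda>i\<in>{j}. X i \<omega>) j) (\<rho> (\<lambda>i\<in>{..<m} - {j}. X i \<omega>'))))"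
    by (intro expectation_indep_pair[OF ind, of "\<lambda>x y. g (x j) (\<rho> y)"]) (auto simp: split_beta' g(2))
  moreover have "\<rho> (\<lambda>i\<in>{..<m} - {j}. X i \<omega>) = R j k \<omega>" for \<omega>
    by (simp add: \<rho>_def R_def)
  ultimately show ?thesis by simp
qed

text \<open>It suffices to shift by \<open>a j *s e\<close>, that is, to translate
  \<open>X j\<close> by \<open>e\<close> divided by \<open>Suc k\<close> while \<open>R j k\<close>
  is frozen. The resulting change of the expectation is at most the L1 modulus of translation of the
  density of \<open>X j\<close>, for every value of \<open>R j k\<close> and every test
  function.\<close>

lemma V_shift_invariant: "asymp_shift_invariant M V s"
proof (rule asymp_shift_invariant_all[OF _ gcd])
  fix c e assume "c \<in> a ` {..<m}"
  then obtain j where j: "j < m" "c = a j" by auto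
  note [measurable] = X_measurable[OF j(1)]
  note cont = continuous_rv_X[OF j(1)]
  define f where "f = lebesgue_density M (X j)"
  define t :: "nat \<Rightarrow> real ^ 'd" where "t k = (1 / real (Suc k)) *\<^sub>R (\<chi> i. of_int (e $ i))" for k
  have f: "integrable lborel f" unfolding f_def by (rule integrable_lebesgue_density[OF _ cont]) measurable
  have "(\<lambda>k. - t k) \<longlonglongrightarrow> - (0 *\<^sub>R (\<chi> i. of_int (e $ i)))"
    unfolding t_def by (intro tendsto_intros LIMSEQ_inverse_real_of_nat[unfolded inverse_eq_divide])
  then have \<tau>: "(\<lambda>k. \<integral>x. \<bar>f (x + - t k) - f x\<bar> \<partial>lborel) \<longlonglongrightarrow> 0"
    by (intro translate_tendsto_L1[OF f]) simp
  show "asymp_shift_invariant M V (c *s e)"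
    unfolding asymp_shift_invariant_def
  proof (intro allI impI)
    fix \<psi> :: "nat \<Rightarrow> int ^ 'd \<Rightarrow> real" assume \<psi>: "\<forall>k v. \<bar>\<psi> k v\<bar> \<le> 1"
    show "(\<lambda>k. expectation (\<lambda>\<omega>. \<psi> k (V k \<omega> + c *s e)) - expectation (\<lambda>\<omega>. \<psi> k (V k \<omega>))) \<longlonglongrightarrow> 0"
    proof (rule Lim_null_comparison[OF always_eventually \<tau>], intro allI)
      fix k
      define g where "g x \<rho> = \<psi> k (a j *s lattice_floor (real (Suc k)) x + \<rho>)" for x :: "real ^ 'd" and \<rho>
      have g[measurable]: "(\<lambda>x. g x \<rho>) \<in> borel_measurable borel" for \<rho>
        unfolding g_def by (rule measurable_compose[OF measurable_lattice_floor]) simp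
      have g': "(\<lambda>x. g (x + t k) \<rho>) \<in> borel_measurable borel" for \<rho> by measurable
      have gb: "\<bar>g x \<rho>\<bar> \<le> 1" for x \<rho> using \<psi> by (simp add: g_def)
      \<comment> \<open>The conditional expectations given \<open>R j k = \<rho>\<close>, without
        and with the translation.\<close>
      define h where "h \<rho> = expectation (\<lambda>\<omega>. g (X j \<omega>) \<rho>)" for \<rho>
      define h' where "h' \<rho> = expectation (\<lambda>\<omega>. g (X j \<omega> + t k) \<rho>)" for \<rho>
      have E: "\<bar>expectation (\<lambda>\<omega>. F (X j \<omega>))\<bar> \<le> 1" if "\<And>x. \<bar>F x\<bar> \<le> 1" "F \<in> borel_measurable borel" for F :: "real ^ 'd \<Rightarrow> real"
      proof -
        have [measurable]: "F \<in> borel_measurable borel" by fact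
        have "\<bar>expectation (\<lambda>\<omega>. F (X j \<omega>))\<bar> \<le> expectation (\<lambda>\<omega>. \<bar>F (X j \<omega>)\<bar>)" by (rule integral_abs_bound)
        also have "\<dots> \<le> expectation (\<lambda>\<omega>. 1)"
          using that by (intro integral_mono integrable_abs integrable_const_bound[of _ 1]) auto
        finally show ?thesis by (simp add: prob_space)
      qed
      have hb: "\<bar>h \<rho>\<bar> \<le> 1" "\<bar>h' \<rho>\<bar> \<le> 1" for \<rho>
        unfolding h_def h'_def using E[of "\<lambda>x. g x \<rho>"] E[of "\<lambda>x. g (x + t k) \<rho>"] gb by auto
      have ih: "integrable M (\<lambda>\<omega>. h (R j k \<omega>))" "integrable M (\<lambda>\<omega>. h' (R j k \<omega>))"
        using integrable_bounded_count_space[OF R_measurable, of h 1]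
          integrable_bounded_count_space[OF R_measurable, of h' 1] hb by auto
      have "V k \<omega> + c *s e = a j *s lattice_floor (real (Suc k)) (X j \<omega> + t k) + R j k \<omega>" for \<omega>
        unfolding V_split[OF j(1)] t_def by (subst lattice_floor_add) (auto simp: j vector_add_ldistrib)
      then have "expectation (\<lambda>\<omega>. \<psi> k (V k \<omega> + c *s e)) = expectation (\<lambda>\<omega>. g (X j \<omega> + t k) (R j k \<omega>))"
        by (simp add: g_def)
      also have "\<dots> = expectation (\<lambda>\<omega>. h' (R j k \<omega>))"
        unfolding h'_def by (rule expectation_split[OF j(1) g' gb])
      finally have 1: "expectation (\<lambda>\<omega>. \<psi> k (V k \<omega> + c *s e)) = expectation (\<lambda>\<omega>. h' (R j k \<omega>))" .
      have "expectation (\<lambda>\<omega>. \<psi> k (V k \<omega>)) = expectation (\<lambda>\<omega>. g (X j \<omega>) (R j k \<omega>))"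
        unfolding V_split[OF j(1)] g_def ..
      also have "\<dots> = expectation (\<lambda>\<omega>. h (R j k \<omega>))"
        unfolding h_def by (rule expectation_split[OF j(1) g gb])
      finally have "expectation (\<lambda>\<omega>. \<psi> k (V k \<omega> + c *s e)) - expectation (\<lambda>\<omega>. \<psi> k (V k \<omega>))
          = expectation (\<lambda>\<omega>. h' (R j k \<omega>) - h (R j k \<omega>))"
        using 1 ih by simp
      also have "\<bar>\<dots>\<bar> \<le> expectation (\<lambda>\<omega>. \<bar>h' (R j k \<omega>) - h (R j k \<omega>)\<bar>)"
        by (rule integral_abs_bound)
      also have "\<dots> \<le> expectation (\<lambda>\<omega>. \<integral>x. \<bar>f (x + - t k) - f x\<bar> \<partial>lborel)"
      proof (rule integral_mono)
        show "\<bar>h' (R j k \<omega>) - h (R j k \<omega>)\<bar> \<le> (\<integral>x. \<bar>f (x + - t k) - f x\<bar> \<partial>lborel)" for \<omega>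
          unfolding h_def h'_def f_def
          by (rule expectation_translate_diff_le[OF _ cont]) (use gb in auto)
      qed (use ih in auto)
      finally show "norm (expectation (\<lambda>\<omega>. \<psi> k (V k \<omega> + c *s e)) - expectation (\<lambda>\<omega>. \<psi> k (V k \<omega>)))
          \<le> (\<integral>x. \<bar>f (x + - t k) - f x\<bar> \<partial>lborel)"
        by (simp add: prob_space)
    qed
  qed
qed simp

text \<open>An integer shift of \<open>Z k\<close> is a small translation of \<open>Y\<close>, so
  the density of \<open>Y\<close> gives the estimate directly, for all shifts at once.\<close>

lemma Z_shift_invariant: "asymp_shift_invariant M Z s"
  unfolding asymp_shift_invariant_def
proof (intro allI impI)
  fix \<psi> :: "nat \<Rightarrow> int ^ 'd \<Rightarrow> real" assume \<psi>: "\<forall>k v. \<bar>\<psi> k v\<bar> \<le> 1"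
  define f where "f = lebesgue_density M Y"
  define t :: "nat \<Rightarrow> real ^ 'd" where "t k = (1 / real (Suc k)) *\<^sub>R (\<chi> i. of_int (s $ i))" for k
  have f: "integrable lborel f"
    unfolding f_def by (rule integrable_lebesgue_density[OF _ continuous_rv_Y]) measurable
  have "(\<lambda>k. - t k) \<longlonglongrightarrow> - (0 *\<^sub>R (\<chi> i. of_int (s $ i)))"
    unfolding t_def by (intro tendsto_intros LIMSEQ_inverse_real_of_nat[unfolded inverse_eq_divide])
  then have \<tau>: "(\<lambda>k. \<integral>x. \<bar>f (x + - t k) - f x\<bar> \<partial>lborel) \<longlonglongrightarrow> 0"
    by (intro translate_tendsto_L1[OF f]) simp
  show "(\<lambda>k. expectation (\<lambda>\<omega>. \<psi> k (Z k \<omega> + s)) - expectation (\<lambda>\<omega>. \<psi> k (Z k \<omega>))) \<longlonglongrightarrow> 0"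
  proof (rule Lim_null_comparison[OF always_eventually \<tau>], intro allI)
    fix k
    define g where "g x = \<psi> k (lattice_floor (real (Suc k)) x)" for x :: "real ^ 'd"
    have g[measurable]: "g \<in> borel_measurable borel"
      unfolding g_def by (rule measurable_compose[OF measurable_lattice_floor]) simp
    have "Z k \<omega> + s = lattice_floor (real (Suc k)) (Y \<omega> + t k)" for \<omega>
      unfolding Z_def t_def by (subst lattice_floor_add) auto
    then have "expectation (\<lambda>\<omega>. \<psi> k (Z k \<omega> + s)) - expectation (\<lambda>\<omega>. \<psi> k (Z k \<omega>)) =
        expectation (\<lambda>\<omega>. g (Y \<omega> + t k)) - expectation (\<lambda>\<omega>. g (Y \<omega>))"
      by (simp add: g_def Z_def)
    also have "\<bar>\<dots>\<bar> \<le> (\<integral>x. \<bar>f (x + - t k) - f x\<bar> \<partial>lborel)"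
      unfolding f_def by (rule expectation_translate_diff_le[OF _ continuous_rv_Y]) (use \<psi> in \<open>auto simp: g_def[symmetric], simp add: g_def\<close>)
    finally show "norm (expectation (\<lambda>\<omega>. \<psi> k (Z k \<omega> + s)) - expectation (\<lambda>\<omega>. \<psi> k (Z k \<omega>)))
        \<le> (\<integral>x. \<bar>f (x + - t k) - f x\<bar> \<partial>lborel)" by simp
  qed
qed

section \<open>Bounded support and bounded cell masses of the quantised laws\<close>

text \<open>The first summand covers \<open>V\<close>, since rounding \<open>r * x\<close> changes
  it by at most \<open>1 \<le> r\<close>, which replaces \<open>B\<close> by \<open>B + 1\<close>.
  The final \<open>1\<close> absorbs the single rounding in \<open>Z\<close>.\<close>

definition K :: real where "K = (\<Sum>j<m. real_of_int \<bar>a j\<bar>) * (B + 1) + 1"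

text \<open>Before the last rounding the difference is a combination of fractional parts with
  coefficients \<open>a j\<close>; rounding \<open>Y\<close> adds at most one. The bound does not
  depend on \<open>k\<close>.\<close>

lemma Z_V_diff: "\<bar>Z k \<omega> $ i - V k \<omega> $ i\<bar> \<le> int (nat (\<Sum>j<m. \<bar>a j\<bar>) + 1)"
proof -
  let ?r = "real (Suc k)"
  have "\<bar>?r * Y \<omega> $ i - of_int (V k \<omega> $ i)\<bar> =
      \<bar>\<Sum>j<m. of_int (a j) * (?r * X j \<omega> $ i - of_int \<lfloor>?r * X j \<omega> $ i\<rfloor>)\<bar>"
    unfolding Y_def V_def lattice_floor_def
    by (simp add: sum_component sum_distrib_left right_diff_distrib sum_subtractf mult.left_commute)
  also have "\<dots> \<le> (\<Sum>j<m. \<bar>of_int (a j) * (?r * X j \<omega> $ i - of_int \<lfloor>?r * X j \<omega> $ i\<rfloor>)\<bar>)"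
    by (rule sum_abs)
  also have "\<dots> \<le> (\<Sum>j<m. real_of_int \<bar>a j\<bar> * 1)"
    unfolding abs_mult by (intro sum_mono mult_mono) (auto, linarith+)
  finally have 1: "\<bar>?r * Y \<omega> $ i - of_int (V k \<omega> $ i)\<bar> \<le> of_int (\<Sum>j<m. \<bar>a j\<bar>)" by simp
  have "Z k \<omega> $ i = \<lfloor>?r * Y \<omega> $ i\<rfloor>" by (simp add: Z_def lattice_floor_def)
  with 1 have "\<bar>Z k \<omega> $ i - V k \<omega> $ i\<bar> \<le> (\<Sum>j<m. \<bar>a j\<bar>) + 1" by linarith
  then show ?thesis by (simp add: sum_nonneg)
qed

text \<open>A finite set of lattice points that almost surely contains both \<open>V k\<close> and
  \<open>Z k\<close>.\<close>

definition S :: "nat \<Rightarrow> (int ^ 'd) set" where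
  "S k = {v. \<forall>i. \<bar>real_of_int (v $ i)\<bar> \<le> real (Suc k) * K}"

lemma finite_S: "finite (S k)"
proof (rule finite_subset)
  define N where "N = \<lceil>real (Suc k) * K\<rceil>"
  show "S k \<subseteq> {s. \<forall>i. - N \<le> s $ i \<and> s $ i < N + 1}"
    unfolding S_def N_def by (auto, (erule_tac x = i in allE, linarith)+)
  show "finite {s :: int ^ 'd. \<forall>i. - N \<le> s $ i \<and> s $ i < N + 1}" by (rule finite_int_cube)
qed

text \<open>Scaled back, all cells indexed by \<open>S k\<close> lie in one cube independent of
  \<open>k\<close>, because rounding loses at most \<open>1 \<le> Suc k\<close>. This provides a
  common bounded support.\<close>

lemma S_lattice_floor:
  assumes "lattice_floor (real (Suc k)) y \<in> S k"
  shows "y \<in> cbox (\<chi> i. - (K + 1)) (\<chi> i. K + 1)"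
proof -
  let ?r = "real (Suc k)"
  have "\<bar>y $ i\<bar> \<le> K + 1" for i
  proof -
    have "\<bar>real_of_int \<lfloor>?r * y $ i\<rfloor>\<bar> \<le> ?r * K"
      using assms by (simp add: S_def lattice_floor_def)
    then have "\<bar>?r * y $ i\<bar> \<le> ?r * K + 1" by linarith
    also have "\<dots> \<le> ?r * (K + 1)" by (simp add: algebra_simps)
    finally show ?thesis by (simp add: abs_mult del: of_nat_Suc)
  qed
  then have "- (K + 1) \<le> y $ i \<and> y $ i \<le> K + 1" for i
    by (simp only: abs_le_iff minus_le_iff)
  then show ?thesis by (simp add: mem_box_cart)
qed

lemma AE_V_Z_S: "AE \<omega> in M. V k \<omega> \<in> S k \<and> Z k \<omega> \<in> S k"
proof -
  let ?r = "real (Suc k)" and ?A = "\<Sum>j<m. real_of_int \<bar>a j\<bar>"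
  have A0: "0 \<le> ?A" by (intro sum_nonneg) auto
  have "AE \<omega> in M. \<forall>j\<in>{..<m}. norm (X j \<omega>) \<le> B"
    using B(2) by (intro AE_finite_allI) auto
  then show ?thesis
  proof eventually_elim
    case (elim \<omega>)
    have x: "\<bar>X j \<omega> $ i\<bar> \<le> B" if "j < m" for j i
      using component_le_norm_cart[of "X j \<omega>" i] elim that by force
    have "\<bar>real_of_int (V k \<omega> $ i)\<bar> \<le> ?r * K" for i
    proof -
      have "\<bar>real_of_int (V k \<omega> $ i)\<bar> = \<bar>\<Sum>j<m. of_int (a j) * of_int \<lfloor>?r * X j \<omega> $ i\<rfloor>\<bar>"
        unfolding V_def lattice_floor_def by (simp add: sum_component)
      also have "\<dots> \<le> (\<Sum>j<m. \<bar>of_int (a j) * of_int \<lfloor>?r * X j \<omega> $ i\<rfloor>\<bar>)" by (rule sum_abs)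
      also have "\<dots> \<le> (\<Sum>j<m. real_of_int \<bar>a j\<bar> * (?r * (B + 1)))"
      proof (rule sum_mono)
        fix j assume "j \<in> {..<m}"
        then have "?r * \<bar>X j \<omega> $ i\<bar> \<le> ?r * B" using x by (intro mult_left_mono) auto
        then have "\<bar>?r * X j \<omega> $ i\<bar> \<le> ?r * B" by (simp add: abs_mult)
        then have "\<bar>real_of_int \<lfloor>?r * X j \<omega> $ i\<rfloor>\<bar> \<le> ?r * B + 1" by linarith
        also have "\<dots> \<le> ?r * (B + 1)" by (simp add: algebra_simps)
        finally show "\<bar>of_int (a j) * of_int \<lfloor>?r * X j \<omega> $ i\<rfloor>\<bar> \<le> real_of_int \<bar>a j\<bar> * (?r * (B + 1))"
          unfolding abs_mult by (intro mult_mono) auto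
      qed
      also have "\<dots> = ?r * (?A * (B + 1))"
        by (simp add: sum_distrib_right sum_distrib_left mult.left_commute mult.commute)
      also have "\<dots> \<le> ?r * K" unfolding K_def by (intro mult_left_mono) auto
      finally show ?thesis .
    qed
    moreover have "\<bar>real_of_int (Z k \<omega> $ i)\<bar> \<le> ?r * K" for i
    proof -
      have "\<bar>Y \<omega> $ i\<bar> \<le> (\<Sum>j<m. \<bar>of_int (a j) * X j \<omega> $ i\<bar>)"
        unfolding Y_def by (simp add: sum_component sum_abs)
      also have "\<dots> \<le> (\<Sum>j<m. real_of_int \<bar>a j\<bar> * B)"
        unfolding abs_mult by (intro sum_mono mult_mono) (auto simp: x)
      also have "\<dots> = ?A * B" by (simp add: sum_distrib_right)
      finally have "\<bar>?r * Y \<omega> $ i\<bar> \<le> ?r * (?A * B)"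
        unfolding abs_mult by (intro mult_mono) auto
      then have "\<bar>real_of_int (Z k \<omega> $ i)\<bar> \<le> ?r * (?A * B) + 1"
        unfolding Z_def lattice_floor_def by simp linarith
      also have "\<dots> \<le> ?r * (?A * B) + ?r * 1" by simp
      also have "\<dots> = ?r * (?A * B + 1)" by (simp only: distrib_left)
      also have "\<dots> \<le> ?r * K" unfolding K_def using A0 by (intro mult_left_mono) (auto simp: algebra_simps)
      finally show ?thesis .
    qed
    ultimately show ?case by (simp add: S_def)
  qed
qed

text \<open>Integers with gcd one include a nonzero \<open>a j\<close>. Given \<open>R j k\<close>,
  the event \<open>V k = v\<close> then confines \<open>X j\<close> to a single cell, whose
  probability is at most \<open>C\<close> times its volume.\<close>

lemma pmass_V_le: "pmass M (V k) v \<le> C * (1 / real (Suc k)) ^ CARD('d)"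
proof -
  let ?r = "real (Suc k)"
  obtain j where j: "j < m" "a j \<noteq> 0"
  proof (rule ccontr)
    assume "\<not> thesis"
    then have "a ` {..<m} \<subseteq> {0}" using that by auto
    then show False using gcd by (metis Gcd_0_iff zero_neq_one)
  qed
  note [measurable] = X_measurable[OF j(1)]
  define g :: "real ^ 'd \<Rightarrow> int ^ 'd \<Rightarrow> real" where
    "g x \<rho> = of_bool (a j *s lattice_floor ?r x + \<rho> = v)" for x \<rho>
  have g[measurable]: "(\<lambda>x. g x \<rho>) \<in> borel_measurable borel" for \<rho>
    unfolding g_def by (rule measurable_compose[OF measurable_lattice_floor]) simp
  have gb: "\<bar>g x \<rho>\<bar> \<le> 1" for x \<rho> by (simp add: g_def)
  have b: "expectation (\<lambda>\<omega>. g (X j \<omega>) \<rho>) \<le> C * (1 / ?r) ^ CARD('d)" for \<rho>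
  proof -
    define A where "A = {x :: real ^ 'd. a j *s lattice_floor ?r x + \<rho> = v}"
    have "{x \<in> space borel. g x \<rho> = 1} \<in> sets borel" by measurable
    then have A: "A \<in> sets borel" by (simp add: A_def g_def)
    have "emeasure lborel A \<le> ennreal ((1 / ?r) ^ CARD('d))"
    proof (cases "A = {}")
      case False
      then obtain y where y: "y \<in> A" by auto
      have "A \<subseteq> {x. lattice_floor ?r x = lattice_floor ?r y}"
      proof
        fix x assume "x \<in> A"
        then have "a j *s lattice_floor ?r x = a j *s lattice_floor ?r y"
          using y by (simp add: A_def) (metis add_right_cancel)
        then show "x \<in> {x. lattice_floor ?r x = lattice_floor ?r y}"
          using j(2) by (simp add: vec_eq_iff)
      qed
      moreover have "{x :: real ^ 'd. lattice_floor ?r x = lattice_floor ?r y} \<in> sets borel"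
        using measurable_sets[OF measurable_lattice_floor, of "{lattice_floor ?r y}" ?r] by (simp add: vimage_def)
      ultimately show ?thesis
        using emeasure_mono[of A "{x. lattice_floor ?r x = lattice_floor ?r y}" lborel]
          emeasure_lattice_cell[of ?r "lattice_floor ?r y"] by simp
    qed simp
    then have "emeasure M (X j -` A \<inter> space M) \<le> ennreal C * ennreal ((1 / ?r) ^ CARD('d))"
      using C(2)[OF j(1) A] by (meson mult_left_mono order_trans zero_le)
    then have le: "measure M (X j -` A \<inter> space M) \<le> C * (1 / ?r) ^ CARD('d)"
      using C(1) by (simp add: emeasure_eq_measure ennreal_mult[symmetric] ennreal_le_iff)
    have "expectation (\<lambda>\<omega>. g (X j \<omega>) \<rho>) = expectation (indicator (X j -` A \<inter> space M))"
      by (intro Bochner_Integration.integral_cong) (auto simp: g_def A_def indicator_def)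
    also have "\<dots> = measure M (X j -` A \<inter> space M)"
      using A by simp
    finally show ?thesis using le by simp
  qed
  have "{\<omega> \<in> space M. V k \<omega> = v} \<in> sets M"
    using measurable_sets[OF V_measurable, of "{v}" k] by (simp add: vimage_def Int_def conj_commute)
  then have "pmass M (V k) v = expectation (indicator {\<omega> \<in> space M. V k \<omega> = v})"
    by (simp add: pmass_def)
  also have "\<dots> = expectation (\<lambda>\<omega>. g (X j \<omega>) (R j k \<omega>))"
    by (intro Bochner_Integration.integral_cong) (auto simp: g_def V_split[OF j(1)] indicator_def)
  also have "\<dots> = expectation (\<lambda>\<omega>'. expectation (\<lambda>\<omega>. g (X j \<omega>) (R j k \<omega>')))"
    by (rule expectation_split[OF j(1) g gb])
  also have "\<dots> \<le> expectation (\<lambda>\<omega>'. C * (1 / ?r) ^ CARD('d))"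
  proof (rule integral_mono)
    show "integrable M (\<lambda>\<omega>'. expectation (\<lambda>\<omega>. g (X j \<omega>) (R j k \<omega>')))"
    proof (rule integrable_bounded_count_space[OF R_measurable])
      fix \<rho>
      have "0 \<le> expectation (\<lambda>\<omega>. g (X j \<omega>) \<rho>)" by (simp add: g_def)
      then show "\<bar>expectation (\<lambda>\<omega>. g (X j \<omega>) \<rho>)\<bar> \<le> C * (1 / ?r) ^ CARD('d)" using b[of \<rho>] by simp
    qed
  qed (use b in auto)
  finally show ?thesis by (simp add: prob_space)
qed

section \<open>The piecewise constant densities and their entropy limit\<close>

definition quantized_density :: "nat \<Rightarrow> real ^ 'd \<Rightarrow> real" where
  "quantized_density k y = real (Suc k) ^ CARD('d) * pmass M (V k) (lattice_floor (real (Suc k)) y)"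

lemma pmass_eq_0:
  assumes "W \<in> M \<rightarrow>\<^sub>M count_space UNIV" "AE \<omega> in M. W \<omega> \<in> A" "v \<notin> A"
  shows "pmass M W v = 0"
proof -
  have "AE \<omega> in M. \<omega> \<notin> {\<omega> \<in> space M. W \<omega> = v}"
    using assms(2) by eventually_elim (use assms(3) in auto)
  moreover have "{\<omega> \<in> space M. W \<omega> = v} \<in> sets M"
    using measurable_sets[OF assms(1), of "{v}"] by (simp add: vimage_def Int_def conj_commute)
  ultimately show ?thesis
    unfolding pmass_def by (subst (asm) AE_iff_null_sets[symmetric]) (auto simp: null_sets_def measure_def)
qed

lemma pmass_outside: "v \<notin> S k \<Longrightarrow> pmass M (V k) v = 0" "v \<notin> S k \<Longrightarrow> pmass M (Z k) v = 0"
  using AE_V_Z_S[of k] by (auto intro!: pmass_eq_0[of _ "S k"])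

lemma quantized_density_measurable[measurable]: "quantized_density k \<in> borel_measurable borel"
  unfolding quantized_density_def[abs_def]
  by (rule measurable_compose[OF measurable_lattice_floor]) simp

lemma integrable_quantized_density: "integrable lborel (quantized_density k)"
  unfolding quantized_density_def[abs_def]
  by (intro integrable_mult_right integrable_lattice_floor[of _ "S k"]) (auto simp: finite_S pmass_outside)

lemma quantized_density_nonneg: "0 \<le> quantized_density k y"
  by (simp add: quantized_density_def pmass_def)

lemma quantized_density_le: "quantized_density k y \<le> C"
proof -
  have "quantized_density k y \<le> real (Suc k) ^ CARD('d) * (C * (1 / real (Suc k)) ^ CARD('d))"
    unfolding quantized_density_def by (intro mult_left_mono pmass_V_le) auto
  also have "\<dots> = C" by (simp add: power_divide del: of_nat_Suc)
  finally show ?thesis .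
qed

lemma quantized_density_outside: "y \<notin> cbox (\<chi> i. - (K + 1)) (\<chi> i. K + 1) \<Longrightarrow> quantized_density k y = 0"
  using S_lattice_floor[of k y] pmass_outside(1)[of "lattice_floor (real (Suc k)) y" k] by (auto simp: quantized_density_def)

text \<open>The mass that the density of \<open>Y\<close> gives to a cell is the probability that
  \<open>Z k\<close> is its index. Hence the cell average and \<open>quantized_density k\<close>
  differ only in using the law of \<open>Z k\<close> or that of \<open>V k\<close>.\<close>

lemma cell_average_density:
  "cell_average (real (Suc k)) (lebesgue_density M Y) y
    = real (Suc k) ^ CARD('d) * pmass M (Z k) (lattice_floor (real (Suc k)) y)"
proof -
  let ?v = "lattice_floor (real (Suc k)) y"
  have [measurable]: "{x :: real ^ 'd. lattice_floor (real (Suc k)) x = ?v} \<in> sets borel"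
    using measurable_sets[OF measurable_lattice_floor, of "{?v}" "real (Suc k)"] by (simp add: vimage_def)
  have "{\<omega> \<in> space M. Z k \<omega> = ?v} \<in> sets M"
    using measurable_sets[OF Z_measurable, of "{?v}" k] by (simp add: vimage_def Int_def conj_commute)
  then have "pmass M (Z k) ?v = expectation (indicator {\<omega> \<in> space M. Z k \<omega> = ?v})"
    by (simp add: pmass_def)
  also have "\<dots> = expectation (\<lambda>\<omega>. indicator {x. lattice_floor (real (Suc k)) x = ?v} (Y \<omega>))"
    by (intro Bochner_Integration.integral_cong) (auto simp: Z_def indicator_def)
  also have "\<dots> = (\<integral>x. lebesgue_density M Y x * indicator {x. lattice_floor (real (Suc k)) x = ?v} x \<partial>lborel)"
    by (rule expectation_lebesgue_density[OF _ continuous_rv_Y]) measurable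
  finally show ?thesis by (simp add: cell_average_def)
qed

text \<open>Testing with the sign of the difference of the two mass functions turns the difference
  of expectations into the full L1 distance. The sign changes with \<open>k\<close>, which is why
  the test functions were allowed to do so.\<close>

lemma pmass_diff_tendsto: "(\<lambda>k. \<Sum>v\<in>S k. \<bar>pmass M (Z k) v - pmass M (V k) v\<bar>) \<longlonglongrightarrow> 0"
proof -
  define \<psi> where "\<psi> k v = sgn (pmass M (Z k) v - pmass M (V k) v)" for k v
  have "(\<lambda>k. expectation (\<lambda>\<omega>. \<psi> k (Z k \<omega>)) - expectation (\<lambda>\<omega>. \<psi> k (V k \<omega>))) \<longlonglongrightarrow> 0"
    by (rule expectation_diff_tendsto_0[OF V_measurable Z_measurable V_shift_invariant Z_shift_invariant Z_V_diff])
      (auto simp: \<psi>_def sgn_real_def)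
  moreover have "expectation (\<lambda>\<omega>. \<psi> k (Z k \<omega>)) - expectation (\<lambda>\<omega>. \<psi> k (V k \<omega>))
      = (\<Sum>v\<in>S k. \<bar>pmass M (Z k) v - pmass M (V k) v\<bar>)" for k
  proof -
    have "expectation (\<lambda>\<omega>. \<psi> k (Z k \<omega>)) = (\<Sum>v\<in>S k. pmass M (Z k) v * \<psi> k v)"
      using AE_V_Z_S by (intro expectation_finite_support finite_S) auto
    moreover have "expectation (\<lambda>\<omega>. \<psi> k (V k \<omega>)) = (\<Sum>v\<in>S k. pmass M (V k) v * \<psi> k v)"
      using AE_V_Z_S by (intro expectation_finite_support finite_S) auto
    ultimately show ?thesis
      by (simp add: sum_subtractf[symmetric] left_diff_distrib[symmetric] \<psi>_def abs_sgn)
  qed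
  ultimately show ?thesis by simp
qed

text \<open>The cell average of the density of \<open>Y\<close> serves as intermediate point: its
  distance to \<open>quantized_density k\<close> is the distance of the laws of \<open>Z k\<close>
  and \<open>V k\<close>, and its distance to the density tends to zero as the mesh shrinks.\<close>

lemma quantized_density_tendsto_L1: "(\<lambda>k. \<integral>y. \<bar>quantized_density k y - lebesgue_density M Y y\<bar> \<partial>lborel) \<longlonglongrightarrow> 0"
proof -
  let ?f = "lebesgue_density M Y" and ?F = "\<lambda>k. cell_average (real (Suc k)) (lebesgue_density M Y)"
  have f: "integrable lborel ?f"
    by (rule integrable_lebesgue_density[OF _ continuous_rv_Y]) measurable
  have F: "integrable lborel (?F k)" for k by (rule integrable_cell_average[OF _ f]) simp
  have eq: "(\<integral>y. \<bar>?F k y - quantized_density k y\<bar> \<partial>lborel) = (\<Sum>v\<in>S k. \<bar>pmass M (Z k) v - pmass M (V k) v\<bar>)" for k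
  proof -
    let ?r = "real (Suc k)"
    have "(\<integral>y. \<bar>?F k y - quantized_density k y\<bar> \<partial>lborel) = (\<integral>y. (\<lambda>v. ?r ^ CARD('d) * \<bar>pmass M (Z k) v - pmass M (V k) v\<bar>) (lattice_floor ?r y) \<partial>lborel)"
      unfolding cell_average_density quantized_density_def
      by (simp add: right_diff_distrib[symmetric] abs_mult del: of_nat_Suc)
    also have "\<dots> = (1 / ?r) ^ CARD('d) * (\<Sum>v\<in>S k. ?r ^ CARD('d) * \<bar>pmass M (Z k) v - pmass M (V k) v\<bar>)"
      by (rule integral_lattice_floor) (auto simp: finite_S pmass_outside)
    also have "\<dots> = (\<Sum>v\<in>S k. \<bar>pmass M (Z k) v - pmass M (V k) v\<bar>)"
      by (simp add: sum_distrib_left[symmetric] power_divide del: of_nat_Suc)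
    finally show ?thesis .
  qed
  have lim: "(\<lambda>k. (\<integral>y. \<bar>?F k y - quantized_density k y\<bar> \<partial>lborel) + (\<integral>y. \<bar>?F k y - ?f y\<bar> \<partial>lborel)) \<longlonglongrightarrow> 0 + 0"
    unfolding eq
    by (intro tendsto_add pmass_diff_tendsto cell_average_tendsto_L1[OF f])
      (auto intro: filterlim_compose[OF filterlim_real_sequentially filterlim_Suc] simp del: of_nat_Suc)
  show ?thesis
  proof (rule Lim_null_comparison[OF always_eventually], intro allI)
    fix k
    have "(\<integral>y. \<bar>quantized_density k y - ?f y\<bar> \<partial>lborel) \<le> (\<integral>y. \<bar>?F k y - quantized_density k y\<bar> + \<bar>?F k y - ?f y\<bar> \<partial>lborel)"
      by (intro integral_mono integrable_abs Bochner_Integration.integrable_add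
          Bochner_Integration.integrable_diff F f integrable_quantized_density) auto
    also have "\<dots> = (\<integral>y. \<bar>?F k y - quantized_density k y\<bar> \<partial>lborel) + (\<integral>y. \<bar>?F k y - ?f y\<bar> \<partial>lborel)"
      by (intro Bochner_Integration.integral_add integrable_abs
          Bochner_Integration.integrable_diff F f integrable_quantized_density)
    finally show "norm (\<integral>y. \<bar>quantized_density k y - ?f y\<bar> \<partial>lborel) \<le> (\<integral>y. \<bar>?F k y - quantized_density k y\<bar> \<partial>lborel) + (\<integral>y. \<bar>?F k y - ?f y\<bar> \<partial>lborel)"
      by simp
  qed (use lim in simp)
qed

text \<open>The height factor cancels the cell volume outside the logarithm; inside it splits off
  \<open>CARD('d) * ln (Suc k)\<close>, weighted by the total mass one.\<close>

lemma integral_entropy_quantized_density: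
  "(\<integral>y. quantized_density k y * ln (1 / quantized_density k y) \<partial>lborel) = shannon_entropy M (V k) - real CARD('d) * ln (real (Suc k))"
proof -
  let ?r = "real (Suc k)" and ?q = "pmass M (V k)"
  have q0: "0 \<le> ?q v" for v by (simp add: pmass_def)
  have "(\<integral>y. quantized_density k y * ln (1 / quantized_density k y) \<partial>lborel) =
      (\<integral>y. (\<lambda>v. ?r ^ CARD('d) * ?q v * ln (1 / (?r ^ CARD('d) * ?q v))) (lattice_floor ?r y) \<partial>lborel)"
    by (simp add: quantized_density_def)
  also have "\<dots> = (1 / ?r) ^ CARD('d) * (\<Sum>v\<in>S k. ?r ^ CARD('d) * ?q v * ln (1 / (?r ^ CARD('d) * ?q v)))"
    by (rule integral_lattice_floor) (auto simp: finite_S pmass_outside)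
  also have "\<dots> = (\<Sum>v\<in>S k. ?q v * ln (1 / (?r ^ CARD('d) * ?q v)))"
    by (simp add: sum_distrib_left[symmetric] mult.assoc power_divide del: of_nat_Suc)
  also have "\<dots> = (\<Sum>v\<in>S k. ?q v * ln (1 / ?q v) - ?q v * (real CARD('d) * ln ?r))"
  proof (intro sum.cong refl)
    fix v
    show "?q v * ln (1 / (?r ^ CARD('d) * ?q v)) = ?q v * ln (1 / ?q v) - ?q v * (real CARD('d) * ln ?r)"
    proof (cases "?q v = 0")
      case False
      then have "?q v > 0" using q0[of v] by simp
      then show ?thesis by (simp add: ln_div ln_mult ln_realpow algebra_simps del: of_nat_Suc)
    qed simp
  qed
  also have "\<dots> = (\<Sum>v\<in>S k. ?q v * ln (1 / ?q v)) - (\<Sum>v\<in>S k. ?q v) * (real CARD('d) * ln ?r)"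
    by (simp add: sum_subtractf sum_distrib_right)
  also have "(\<Sum>v\<in>S k. ?q v) = 1"
    using expectation_finite_support[OF V_measurable finite_S, of k k "\<lambda>_. 1"] AE_V_Z_S[of k]
    by (simp add: prob_space)
  also have "(\<Sum>v\<in>S k. ?q v * ln (1 / ?q v)) = shannon_entropy M (V k)"
    unfolding shannon_entropy_def infsum_finite[OF finite_S, symmetric]
    by (rule infsum_cong_neutral) (auto simp: pmass_outside)
  finally show ?thesis by simp
qed

lemma finite_shannon_entropy_V: "finite_shannon_entropy M (V k)"
proof -
  have "(\<lambda>u. pmass M (V k) u * ln (1 / pmass M (V k) u)) summable_on S k"
    by (rule summable_on_finite[OF finite_S])
  then show ?thesis unfolding finite_shannon_entropy_def
    by (rule summable_on_cong_neutral[THEN iffD1, rotated -1]) (auto simp: pmass_outside)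
qed

text \<open>The densities are bounded by \<open>C\<close> and vanish outside one cube for all
  \<open>k\<close>, so a constant multiple of the indicator of this cube dominates their entropy
  integrands.\<close>

lemma shannon_entropy_tendsto:
  "(\<lambda>k. shannon_entropy M (V k) - real CARD('d) * ln (real (Suc k))) \<longlonglongrightarrow> differential_entropy M Y"
  unfolding integral_entropy_quantized_density[symmetric] differential_entropy_def
proof (rule integral_entropy_tendsto)
  let ?B = "cbox (\<chi> i. - (K + 1)) (\<chi> i. K + 1) :: (real ^ 'd) set"
  show "integrable lborel (\<lambda>x. (\<bar>C * ln (1 / C)\<bar> + C) * indicator ?B x)"
    using emeasure_lborel_cbox_finite[of "\<chi> i. - (K + 1)" "\<chi> i. K + 1"]
    by (intro integrable_mult_right) (simp add: integrable_indicator_iff)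
  show "AE x in lborel. \<bar>quantized_density k x * ln (1 / quantized_density k x)\<bar> \<le> (\<bar>C * ln (1 / C)\<bar> + C) * indicator ?B x" for k
    using abs_entropy_integrand_le[OF quantized_density_nonneg quantized_density_le] quantized_density_outside
    by (intro AE_I2) (auto split: split_indicator)
  show "integrable lborel (lebesgue_density M Y)"
    by (rule integrable_lebesgue_density[OF _ continuous_rv_Y]) measurable
qed (auto intro: integrable_quantized_density quantized_density_nonneg quantized_density_tendsto_L1 simp: lebesgue_density_nonneg[OF Y_measurable continuous_rv_Y])

end

section \<open>Truncation\<close>

text \<open>The conditioning event is an intersection of events each depending on a single
  \<open>X j\<close>, so numerator and denominator of a conditional probability both factor.\<close>

lemma (in prob_space) indep_vars_uniform_measure:
  fixes X :: "nat \<Rightarrow> 'a \<Rightarrow> 'b" and E :: "nat \<Rightarrow> 'b set"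
  assumes indep: "indep_vars (\<lambda>_. S) X {..<m}" and E: "\<And>j. j < m \<Longrightarrow> E j \<in> sets S"
    and A: "A = {\<omega> \<in> space M. \<forall>j<m. X j \<omega> \<in> E j}" and pos: "prob A > 0" and m: "m > 0"
  shows "prob_space.indep_vars (uniform_measure M A) (\<lambda>_. S) X {..<m}"
proof -
  have X: "X j \<in> M \<rightarrow>\<^sub>M S" if "j < m" for j using indep that by (auto simp: indep_vars_def)
  have XS[simp]: "X j \<omega> \<in> space S" if "j < m" "\<omega> \<in> space M" for j \<omega>
    using X[OF that(1)] that(2) by (rule measurable_space)
  have Am: "A \<in> sets M" using pos measure_notin_sets by fastforce
  interpret U: prob_space "uniform_measure M A"
    using pos by (intro prob_space_uniform_measure) (auto simp: emeasure_eq_measure)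
  \<comment> \<open>The probability of \<open>X j\<close> lying in \<open>B\<close> given that it
    lies in \<open>E j\<close>. The singleton case of \<open>main\<close> later identifies it with
    the marginal under the conditioned measure.\<close>
  define c where "c j B = prob (X j -` (E j \<inter> B) \<inter> space M) / prob (X j -` E j \<inter> space M)" for j B
  have A_eq: "A = (\<Inter>j\<in>{..<m}. X j -` E j \<inter> space M)" using m unfolding A by auto
  have pA: "prob A = (\<Prod>j<m. prob (X j -` E j \<inter> space M))"
    unfolding A_eq using m by (intro indep_varsD_finite[OF indep]) (auto intro: E)
  have main: "U.prob (\<Inter>j\<in>J. X j -` B j \<inter> space M) = (\<Prod>j\<in>J. c j (B j))"
    if J: "J \<noteq> {}" "J \<subseteq> {..<m}" and B: "\<And>j. j \<in> J \<Longrightarrow> B j \<in> sets S" for J B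
  proof -
    \<comment> \<open>Padding with the whole space lets the product run over all indices; the added
      factors are \<open>1\<close>, their denominators being nonzero because \<open>A\<close> has
      positive probability.\<close>
    define B' where "B' j = (if j \<in> J then B j else space S)" for j
    have B': "B' j \<in> sets S" for j using B by (auto simp: B'_def)
    have fJ: "finite J" using J finite_subset by blast
    have Bm: "(\<Inter>j\<in>J. X j -` B j \<inter> space M) \<in> sets M"
      using J B fJ by (intro sets.finite_INT measurable_sets[OF X]) auto
    have "A \<inter> (\<Inter>j\<in>J. X j -` B j \<inter> space M) = (\<Inter>j\<in>{..<m}. X j -` (E j \<inter> B' j) \<inter> space M)"
      using J m unfolding A B'_def by (auto split: if_splits)
    then have "U.prob (\<Inter>j\<in>J. X j -` B j \<inter> space M) = prob (\<Inter>j\<in>{..<m}. X j -` (E j \<inter> B' j) \<inter> space M) / prob A"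
      using pos Bm by (subst measure_uniform_measure) (auto simp: emeasure_eq_measure)
    also have "prob (\<Inter>j\<in>{..<m}. X j -` (E j \<inter> B' j) \<inter> space M) = (\<Prod>j<m. prob (X j -` (E j \<inter> B' j) \<inter> space M))"
      using m by (intro indep_varsD_finite[OF indep]) (auto intro: E B')
    also have "\<dots> / prob A = (\<Prod>j<m. c j (B' j))"
      unfolding pA c_def by (rule prod_dividef[symmetric])
    also have "\<dots> = (\<Prod>j\<in>J. c j (B' j))"
    proof (rule prod.mono_neutral_right)
      show "\<forall>j\<in>{..<m} - J. c j (B' j) = 1"
      proof
        fix j assume j: "j \<in> {..<m} - J"
        have "E j \<inter> B' j = E j" using j sets.sets_into_space[OF E] by (auto simp: B'_def)
        moreover have "prob (X j -` E j \<inter> space M) \<noteq> 0"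
        proof
          assume "prob (X j -` E j \<inter> space M) = 0"
          then have "prob A = 0" unfolding pA using j by (intro prod_zero) auto
          then show False using pos by simp
        qed
        ultimately show "c j (B' j) = 1" by (simp add: c_def)
      qed
    qed (use J in auto)
    also have "\<dots> = (\<Prod>j\<in>J. c j (B j))" by (simp add: B'_def)
    finally show ?thesis .
  qed
  show ?thesis
    unfolding U.indep_vars_def2
  proof (intro conjI ballI U.indep_setsI)
    fix J F assume J: "J \<noteq> {}" "J \<subseteq> {..<m}" "finite J"
      and F: "\<forall>j\<in>J. F j \<in> {X j -` B \<inter> space (uniform_measure M A) |B. B \<in> sets S}"
    then have "\<forall>j\<in>J. \<exists>B. F j = X j -` B \<inter> space M \<and> B \<in> sets S" by auto
    then obtain B where B: "\<And>j. j \<in> J \<Longrightarrow> F j = X j -` B j \<inter> space M \<and> B j \<in> sets S"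
      by (auto dest!: bchoice)
    have "U.prob (\<Inter>j\<in>J. F j) = U.prob (\<Inter>j\<in>J. X j -` B j \<inter> space M)"
      using B by (intro arg_cong[of _ _ U.prob]) auto
    also have "\<dots> = (\<Prod>j\<in>J. c j (B j))" using J B by (intro main) auto
    also have "\<dots> = (\<Prod>j\<in>J. U.prob (F j))"
    proof (intro prod.cong refl)
      fix j assume j: "j \<in> J"
      then show "c j (B j) = U.prob (F j)"
        using main[of "{j}" B] J B[OF j] by auto
    qed
    finally show "U.prob (\<Inter>j\<in>J. F j) = (\<Prod>j\<in>J. U.prob (F j))" .
  qed (use X in \<open>auto simp: measurable_sets\<close>)
qed

lemma (in prob_space) continuous_rv_uniform_measure:
  fixes Y :: "'a \<Rightarrow> 'b::euclidean_space"
  assumes Y[measurable]: "Y \<in> borel_measurable M" and cont: "continuous_rv M Y" and A: "A \<in> sets M"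
  shows "continuous_rv (uniform_measure M A) Y"
  unfolding continuous_rv_def absolutely_continuous_def
proof
  fix N :: "'b set" assume N: "N \<in> null_sets lborel"
  then have Ns: "N \<in> sets borel" by (auto simp: null_sets_def)
  have "N \<in> null_sets (distr M lborel Y)"
    using cont N by (auto simp: continuous_rv_def absolutely_continuous_def)
  then have 0: "emeasure M (Y -` N \<inter> space M) = 0"
    using Ns by (auto simp: null_sets_def emeasure_distr)
  have "emeasure M (A \<inter> (Y -` N \<inter> space M)) \<le> emeasure M (Y -` N \<inter> space M)"
    using Ns by (intro emeasure_mono measurable_sets[OF Y]) auto
  then have "emeasure M (A \<inter> (Y -` N \<inter> space M)) = 0"
    using 0 by simp
  then show "N \<in> null_sets (distr (uniform_measure M A) lborel Y)"
    using Ns A measurable_sets[OF Y Ns] by (auto simp: null_sets_def emeasure_distr)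
qed

text \<open>The conditioned law times \<open>prob A\<close> is dominated by the original law.
  Applied to the set where the claimed inequality fails, this gives a nonnegative integrand with
  integral at most zero, which hence vanishes almost everywhere.\<close>

lemma (in prob_space) uniform_measure_density_le:
  fixes Y :: "'a \<Rightarrow> 'b::euclidean_space"
  assumes Y[measurable]: "Y \<in> borel_measurable M" and cont: "continuous_rv M Y"
    and A[measurable]: "A \<in> sets M" and pos: "prob A > 0"
  shows "AE x in lborel. prob A * lebesgue_density (uniform_measure M A) Y x \<le> lebesgue_density M Y x"
proof -
  interpret U: prob_space "uniform_measure M A"
    using pos by (intro prob_space_uniform_measure) (auto simp: emeasure_eq_measure)
  have YU[measurable]: "Y \<in> borel_measurable (uniform_measure M A)" using Y by simp
  note contU = continuous_rv_uniform_measure[OF Y cont A]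
  let ?f = "lebesgue_density M Y" and ?v = "lebesgue_density (uniform_measure M A) Y"
  note [measurable] = lebesgue_density_measurable[OF Y cont] U.lebesgue_density_measurable[OF YU contU]
  note f = integrable_lebesgue_density[OF Y cont] and v = U.integrable_lebesgue_density[OF YU contU]
  define N where "N = {x. ?f x < prob A * ?v x}"
  have N[measurable]: "N \<in> sets borel" unfolding N_def by measurable
  have if_N: "integrable lborel (\<lambda>x. h x * indicator N x)" if "integrable lborel h" for h :: "'b \<Rightarrow> real"
    using integrable_mult_indicator[OF _ that, of N] by (simp add: mult.commute)
  have "(\<integral>x. ?f x * indicator N x \<partial>lborel) = expectation (\<lambda>\<omega>. indicator N (Y \<omega>))"
    by (rule expectation_lebesgue_density[OF Y cont, symmetric]) measurable
  also have "\<dots> = expectation (indicator (Y -` N \<inter> space M))"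
    by (intro Bochner_Integration.integral_cong) (auto simp: indicator_def)
  also have "\<dots> = prob (Y -` N \<inter> space M)" using measurable_sets[OF Y N] by simp
  finally have 1: "(\<integral>x. ?f x * indicator N x \<partial>lborel) = prob (Y -` N \<inter> space M)" .
  have "(\<integral>x. ?v x * indicator N x \<partial>lborel) = U.expectation (\<lambda>\<omega>. indicator N (Y \<omega>))"
    by (rule U.expectation_lebesgue_density[OF YU contU, symmetric]) measurable
  also have "\<dots> = U.expectation (indicator (Y -` N \<inter> space M))"
    by (intro Bochner_Integration.integral_cong) (auto simp: indicator_def)
  also have "\<dots> = U.prob (Y -` N \<inter> space M)" using measurable_sets[OF Y N] by simp
  also have "\<dots> = prob (A \<inter> (Y -` N \<inter> space M)) / prob A"
    using pos measurable_sets[OF Y N] by (subst measure_uniform_measure) (auto simp: emeasure_eq_measure)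
  finally have 2: "prob A * (\<integral>x. ?v x * indicator N x \<partial>lborel) = prob (A \<inter> (Y -` N \<inter> space M))"
    using pos by simp
  have "(\<integral>x. (prob A * ?v x - ?f x) * indicator N x \<partial>lborel) =
      prob (A \<inter> (Y -` N \<inter> space M)) - prob (Y -` N \<inter> space M)"
    unfolding 1[symmetric] 2[symmetric] left_diff_distrib mult.assoc
    using if_N[OF f] if_N[OF v] by simp
  also have "\<dots> \<le> 0"
    using finite_measure_mono[OF Int_lower2 measurable_sets[OF Y N], of A] by simp
  finally have le: "(\<integral>x. (prob A * ?v x - ?f x) * indicator N x \<partial>lborel) \<le> 0" .
  have nn: "0 \<le> (prob A * ?v x - ?f x) * indicator N x" for x
    by (auto simp: N_def indicator_def)
  have int: "integrable lborel (\<lambda>x. (prob A * ?v x - ?f x) * indicator N x)"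
    using f v by (intro if_N) simp
  have "(\<integral>x. (prob A * ?v x - ?f x) * indicator N x \<partial>lborel) = 0"
    using le nn by (intro antisym integral_nonneg) auto
  then have "AE x in lborel. (prob A * ?v x - ?f x) * indicator N x = 0"
    using integral_nonneg_eq_0_iff_AE[OF int] nn by auto
  then show ?thesis
    by eventually_elim (auto simp: N_def indicator_def split: if_splits)
qed

text \<open>With conditioning probability at least one half the new density is at most twice the old
  one, which yields the majorant. The L1 distance is at most
  \<open>2 * (1 - prob (A N))\<close>.\<close>

lemma (in prob_space) differential_entropy_uniform_measure_tendsto:
  fixes Y :: "'a \<Rightarrow> 'b::euclidean_space"
  assumes Y[measurable]: "Y \<in> borel_measurable M" and fin: "finite_differential_entropy M Y"
    and A[measurable]: "\<And>N. A N \<in> sets M" and half: "\<And>N. prob (A N) \<ge> 1 / 2"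
    and lim: "(\<lambda>N. prob (A N)) \<longlonglongrightarrow> 1"
  shows "(\<lambda>N. differential_entropy (uniform_measure M (A N)) Y) \<longlonglongrightarrow> differential_entropy M Y"
proof -
  have cont: "continuous_rv M Y" using fin by (simp add: finite_differential_entropy_def)
  have pos: "prob (A N) > 0" for N using half[of N] by simp
  have U: "prob_space (uniform_measure M (A N))" for N
    using pos[of N] by (intro prob_space_uniform_measure) (auto simp: emeasure_eq_measure)
  have YU: "Y \<in> borel_measurable (uniform_measure M (A N))" for N using Y by simp
  note contU = continuous_rv_uniform_measure[OF Y cont A]
  let ?f = "lebesgue_density M Y" and ?v = "\<lambda>N. lebesgue_density (uniform_measure M (A N)) Y"
  note f = integrable_lebesgue_density[OF Y cont]
    and v = prob_space.integrable_lebesgue_density[OF U YU contU]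
  have f0: "0 \<le> ?f x" for x by (rule lebesgue_density_nonneg[OF Y cont])
  have v0: "0 \<le> ?v N x" for N x by (rule prob_space.lebesgue_density_nonneg[OF U YU contU])
  have If: "(\<integral>x. ?f x \<partial>lborel) = 1"
    using expectation_lebesgue_density[OF Y cont, of "\<lambda>_. 1"] by (simp add: prob_space)
  have Iv: "(\<integral>x. ?v N x \<partial>lborel) = 1" for N
  proof -
    have "(\<integral>x. ?v N x \<partial>lborel) = (\<integral>x. ?v N x * 1 \<partial>lborel)" by (simp only: mult_1_right)
    also have "\<dots> = (\<integral>\<omega>. 1 \<partial>uniform_measure M (A N))"
      by (rule prob_space.expectation_lebesgue_density[OF U YU contU, symmetric]) (rule measurable_const, simp)
    also have "\<dots> = measure (uniform_measure M (A N)) (space (uniform_measure M (A N)))"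
      by (simp only: lebesgue_integral_const real_scaleR_def mult_1_right)
    also have "\<dots> = 1" by (rule prob_space.prob_space[OF U])
    finally show ?thesis .
  qed
  have le: "AE x in lborel. prob (A N) * ?v N x \<le> ?f x" for N
    by (rule uniform_measure_density_le[OF Y cont A pos])
  have L1: "(\<integral>x. \<bar>?v N x - ?f x\<bar> \<partial>lborel) \<le> 2 * (1 - prob (A N))" for N
  proof -
    \<comment> \<open>Almost everywhere \<open>prob (A N) * ?v N x\<close> lies below both
      densities, so their distance is at most the sum of the two nonnegative excesses over
      it.\<close>
    have "(\<integral>x. \<bar>?v N x - ?f x\<bar> \<partial>lborel) \<le> (\<integral>x. (?v N x - prob (A N) * ?v N x) + (?f x - prob (A N) * ?v N x) \<partial>lborel)"
    proof (rule integral_mono_AE)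
      show "AE x in lborel. \<bar>?v N x - ?f x\<bar> \<le> (?v N x - prob (A N) * ?v N x) + (?f x - prob (A N) * ?v N x)"
        using le[of N]
      proof eventually_elim
        case (elim x)
        have "prob (A N) * ?v N x \<le> 1 * ?v N x" by (intro mult_right_mono v0) simp
        then show ?case using elim by linarith
      qed
    qed (use f v in auto)
    also have "\<dots> = 2 * (1 - prob (A N))" using f v by (simp add: If Iv)
    finally show ?thesis .
  qed
  have "(\<lambda>N. 2 * (1 - prob (A N))) \<longlonglongrightarrow> 2 * (1 - 1)" by (intro tendsto_intros lim)
  then have bound: "(\<lambda>N. 2 * (1 - prob (A N))) \<longlonglongrightarrow> 0" by simp
  have "norm (\<integral>x. \<bar>?v N x - ?f x\<bar> \<partial>lborel) \<le> 2 * (1 - prob (A N))" for N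
    unfolding real_norm_def by (subst abs_of_nonneg) (rule Bochner_Integration.integral_nonneg, rule abs_ge_zero, rule L1)
  then have lim_L1: "(\<lambda>N. \<integral>x. \<bar>?v N x - ?f x\<bar> \<partial>lborel) \<longlonglongrightarrow> 0"
    by (intro Lim_null_comparison[OF always_eventually bound]) blast
  have dom: "integrable lborel (\<lambda>x. \<bar>2 * ?f x * ln (1 / (2 * ?f x))\<bar> + 2 * ?f x)"
  proof -
    \<comment> \<open>Doubling the density adds only a multiple of the density itself, so finiteness
      of the entropy of \<open>Y\<close> makes the majorant integrable.\<close>
    have eq: "2 * ?f x * ln (1 / (2 * ?f x)) = 2 * (?f x * ln (1 / ?f x)) - 2 * ln 2 * ?f x" for x
    proof (cases "?f x = 0")
      case False
      then have "ln (1 / (2 * ?f x)) = ln (1 / ?f x) - ln 2"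
        using f0[of x] by (simp add: ln_div ln_mult)
      then show ?thesis by (simp only: right_diff_distrib mult.assoc mult.commute[of "ln 2"])
    qed simp
    have "integrable lborel (\<lambda>x. ?f x * ln (1 / ?f x))"
      using fin by (simp only: finite_differential_entropy_def)
    then show ?thesis
      unfolding eq using f
      by (intro Bochner_Integration.integrable_add integrable_abs Bochner_Integration.integrable_diff
          integrable_mult_right)
  qed
  have bd: "AE x in lborel. \<bar>?v N x * ln (1 / ?v N x)\<bar> \<le> \<bar>2 * ?f x * ln (1 / (2 * ?f x))\<bar> + 2 * ?f x" for N
    using le[of N]
  proof eventually_elim
    case (elim x)
    have "1 / 2 * ?v N x \<le> prob (A N) * ?v N x" by (intro mult_right_mono v0 half)
    then have "?v N x \<le> 2 * ?f x" using elim by simp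
    then show ?case by (intro abs_entropy_integrand_le v0)
  qed
  show ?thesis
    unfolding differential_entropy_def
    by (rule integral_entropy_tendsto[OF v f v0 f0 lim_L1 dom bd])
qed


section \<open>Transfer to continuous random vectors\<close>

text \<open>The discrete inequality is assumed for measures on one fixed type of sample points. The
  joint law of the \<open>W j\<close> lives on that type, and its coordinate projections reproduce
  both the independence and the laws of all the sums.\<close>

lemma (in prob_space) shannon_entropy_le_transfer:
  fixes W :: "nat \<Rightarrow> 'a \<Rightarrow> int ^ 'd" and a :: "nat \<Rightarrow> nat \<Rightarrow> int"
  assumes discrete_ineq:
      "\<forall>(N :: (nat \<Rightarrow> int ^ 'd) measure) (U :: nat \<Rightarrow> (nat \<Rightarrow> int ^ 'd) \<Rightarrow> int ^ 'd).
         prob_space N \<and> prob_space.indep_vars N (\<lambda>_. count_space UNIV) U {..<m} \<and>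
         (\<forall>i<n. finite_shannon_entropy N (\<lambda>\<omega>. \<Sum>j<m. a i j *s U j \<omega>))
         \<longrightarrow> (\<Sum>i<n. \<alpha> i * shannon_entropy N (\<lambda>\<omega>. \<Sum>j<m. a i j *s U j \<omega>)) \<le> 0"
    and m: "m > 0" and indep: "indep_vars (\<lambda>_. count_space UNIV) W {..<m}"
    and fin: "\<And>i. i < n \<Longrightarrow> finite_shannon_entropy M (\<lambda>\<omega>. \<Sum>j<m. a i j *s W j \<omega>)"
  shows "(\<Sum>i<n. \<alpha> i * shannon_entropy M (\<lambda>\<omega>. \<Sum>j<m. a i j *s W j \<omega>)) \<le> 0"
proof -
  let ?P = "PiM {..<m} (\<lambda>_. count_space UNIV) :: (nat \<Rightarrow> int ^ 'd) measure"
  define F where "F \<omega> = (\<lambda>j\<in>{..<m}. W j \<omega>)" for \<omega>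
  define N where "N = distr M ?P F"
  have W: "W j \<in> M \<rightarrow>\<^sub>M count_space UNIV" if "j < m" for j
    using indep that by (auto simp: indep_vars_def)
  have F[measurable]: "F \<in> M \<rightarrow>\<^sub>M ?P"
    unfolding F_def[abs_def] using W by (intro measurable_restrict) auto
  interpret N: prob_space N unfolding N_def by (rule prob_space_distr) measurable
  have comp: "(\<lambda>x. x j) \<in> ?P \<rightarrow>\<^sub>M count_space UNIV" if "j < m" for j
    using that by (intro measurable_component_singleton) auto
  have ind: "N.indep_vars (\<lambda>_. count_space UNIV) (\<lambda>j x. x j) {..<m}"
  proof (subst N.indep_vars_iff_distr_eq_PiM')
    have "distr N ?P (\<lambda>x. \<lambda>i\<in>{..<m}. x i) = distr M ?P (\<lambda>\<omega>. \<lambda>i\<in>{..<m}. W i \<omega>)"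
    proof -
      have [measurable]: "(\<lambda>x. \<lambda>i\<in>{..<m}. x i) \<in> ?P \<rightarrow>\<^sub>M ?P"
        by (rule measurable_restrict) (use comp in auto)
      have "distr N ?P (\<lambda>x. \<lambda>i\<in>{..<m}. x i) = distr M ?P ((\<lambda>x. \<lambda>i\<in>{..<m}. x i) \<circ> F)"
        unfolding N_def by (rule distr_distr) measurable
      also have "(\<lambda>x. \<lambda>i\<in>{..<m}. x i) \<circ> F = (\<lambda>\<omega>. \<lambda>i\<in>{..<m}. W i \<omega>)"
        by (auto simp: F_def restrict_def fun_eq_iff)
      finally show ?thesis .
    qed
    also have "\<dots> = PiM {..<m} (\<lambda>j. distr M (count_space UNIV) (W j))"
      using indep m W by (subst (asm) indep_vars_iff_distr_eq_PiM') auto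
    also have "\<dots> = PiM {..<m} (\<lambda>j. distr N (count_space UNIV) (\<lambda>x. x j))"
    proof (intro PiM_cong refl)
      fix j assume j: "j \<in> {..<m}"
      then show "distr M (count_space UNIV) (W j) = distr N (count_space UNIV) (\<lambda>x. x j)"
        unfolding N_def using comp[of j] by (subst distr_distr) (auto intro!: distr_cong simp: F_def)
    qed
    finally show "distr N ?P (\<lambda>x. \<lambda>i\<in>{..<m}. x i) = PiM {..<m} (\<lambda>j. distr N (count_space UNIV) (\<lambda>x. x j))" .
  qed (use m comp in \<open>auto simp: N_def\<close>)
  have pm: "pmass N (\<lambda>x. \<Sum>j<m. a i j *s x j) = pmass M (\<lambda>\<omega>. \<Sum>j<m. a i j *s W j \<omega>)" for i
  proof
    fix u
    have "(\<lambda>x. \<Sum>j<m. a i j *s x j) \<in> ?P \<rightarrow>\<^sub>M count_space UNIV"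
    proof (rule measurable_sum_count_space)
      fix j assume "j \<in> {..<m}"
      then show "(\<lambda>x. a i j *s x j) \<in> ?P \<rightarrow>\<^sub>M count_space UNIV"
        by (intro measurable_compose[OF comp]) auto
    qed
    from measurable_sets[OF this, of "{u}"]
    have "{x \<in> space ?P. (\<Sum>j<m. a i j *s x j) = u} \<in> sets ?P"
      by (simp add: vimage_def Int_def conj_commute)
    then have "pmass N (\<lambda>x. \<Sum>j<m. a i j *s x j) u =
        prob (F -` {x \<in> space ?P. (\<Sum>j<m. a i j *s x j) = u} \<inter> space M)"
      unfolding pmass_def N_def by (simp add: measure_distr)
    also have "F -` {x \<in> space ?P. (\<Sum>j<m. a i j *s x j) = u} \<inter> space M
        = {\<omega> \<in> space M. (\<Sum>j<m. a i j *s W j \<omega>) = u}"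
      using measurable_space[OF F] by (auto simp: F_def)
    finally show "pmass N (\<lambda>x. \<Sum>j<m. a i j *s x j) u = pmass M (\<lambda>\<omega>. \<Sum>j<m. a i j *s W j \<omega>) u"
      by (simp add: pmass_def)
  qed
  have "(\<Sum>i<n. \<alpha> i * shannon_entropy N (\<lambda>x. \<Sum>j<m. a i j *s x j)) \<le> 0"
    using fin by (intro discrete_ineq[rule_format] conjI N.prob_space_axioms ind)
      (auto simp: finite_shannon_entropy_def pm)
  then show ?thesis by (simp add: shannon_entropy_def pm)
qed

theorem theorem1:
  fixes n m :: nat and a :: "nat \<Rightarrow> nat \<Rightarrow> int" and \<alpha> :: "nat \<Rightarrow> real"
    and M :: "'a measure" and X :: "nat \<Rightarrow> 'a \<Rightarrow> real ^ 'd"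
  assumes coprime: "\<forall>i<n. Gcd ((\<lambda>j. a i j) ` {..<m}) = 1"
    and alpha_sum: "(\<Sum>i<n. \<alpha> i) = 0"
    and discrete_ineq:
      "\<forall>(N :: (nat \<Rightarrow> int ^ 'd) measure) (U :: nat \<Rightarrow> (nat \<Rightarrow> int ^ 'd) \<Rightarrow> int ^ 'd).
         prob_space N \<and> prob_space.indep_vars N (\<lambda>_. count_space UNIV) U {..<m} \<and>
         (\<forall>i<n. finite_shannon_entropy N (\<lambda>\<omega>. \<Sum>j<m. a i j *s U j \<omega>))
         \<longrightarrow> (\<Sum>i<n. \<alpha> i * shannon_entropy N (\<lambda>\<omega>. \<Sum>j<m. a i j *s U j \<omega>)) \<le> 0"
    and M: "prob_space M"
    and indep: "prob_space.indep_vars M (\<lambda>_. borel) X {..<m}"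
    and cont: "\<forall>j<m. continuous_rv M (X j)"
    and fin: "\<forall>i<n. finite_differential_entropy M (\<lambda>\<omega>. \<Sum>j<m. real_of_int (a i j) *\<^sub>R X j \<omega>)"
  shows "(\<Sum>i<n. \<alpha> i * differential_entropy M (\<lambda>\<omega>. \<Sum>j<m. real_of_int (a i j) *\<^sub>R X j \<omega>)) \<le> 0"
proof (cases "n = 0")
  case False
  interpret prob_space M by (rule M)
  \<comment> \<open>The gcd of the empty set is \<open>0\<close>, so a coprime row cannot be
    empty.\<close>
  have m: "m > 0"
  proof (rule ccontr)
    assume "\<not> m > 0"
    then have "Gcd ((\<lambda>j. a 0 j) ` {..<m}) = 0" by simp
    then show False using coprime False by auto
  qed
  have X: "X j \<in> borel_measurable M" if "j < m" for j
    using indep that by (auto simp: indep_vars_def)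
  define Y where "Y i \<omega> = (\<Sum>j<m. real_of_int (a i j) *\<^sub>R X j \<omega>)" for i \<omega>
  have Y: "Y i \<in> borel_measurable M" for i
    unfolding Y_def[abs_def] using X by (intro borel_measurable_sum) auto
  define f where "f j = lebesgue_density M (X j)" for j
  have f[measurable]: "f j \<in> borel_measurable borel" if "j < m" for j
    unfolding f_def by (intro lebesgue_density_measurable X that cont[rule_format])
  \<comment> \<open>Cutting off the density as well as the vector gives each conditioned
    \<open>X j\<close> both a bounded range and a bounded density.\<close>
  define E where "E N j = {x. norm x \<le> real N \<and> f j x \<le> real N}" for N j
  have E: "E N j \<in> sets borel" if "j < m" for N j
    using f[OF that] unfolding E_def by measurable
  define A where "A N = {\<omega> \<in> space M. \<forall>j<m. X j \<omega> \<in> E N j}" for N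
  have A_eq: "A N = (\<Inter>j\<in>{..<m}. X j -` E N j \<inter> space M)" for N
    using m by (auto simp: A_def)
  have A: "A N \<in> sets M" for N
    unfolding A_eq using m E by (intro sets.finite_INT measurable_sets[OF X]) auto
  have "incseq A"
    by (rule incseq_SucI) (force simp: A_def E_def)
  then have "(\<lambda>N. prob (A N)) \<longlonglongrightarrow> prob (\<Union>N. A N)"
    using A by (intro finite_Lim_measure_incseq) auto
  also have "(\<Union>N. A N) = space M"
  proof (intro equalityI subsetI)
    fix \<omega> assume \<omega>: "\<omega> \<in> space M"
    define N where "N = (\<Sum>j<m. nat \<lceil>norm (X j \<omega>)\<rceil> + nat \<lceil>f j (X j \<omega>)\<rceil>)"
    have "X j \<omega> \<in> E N j" if j: "j < m" for j
    proof -
      have "nat \<lceil>norm (X j \<omega>)\<rceil> + nat \<lceil>f j (X j \<omega>)\<rceil> \<le> N"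
        unfolding N_def using j
        by (intro member_le_sum[of j "{..<m}" "\<lambda>j. nat \<lceil>norm (X j \<omega>)\<rceil> + nat \<lceil>f j (X j \<omega>)\<rceil>"]) auto
      then have "norm (X j \<omega>) \<le> real N \<and> f j (X j \<omega>) \<le> real N" by linarith
      then show ?thesis by (simp add: E_def)
    qed
    then show "\<omega> \<in> (\<Union>N. A N)" using \<omega> by (auto simp: A_def)
  qed (auto simp: A_def)
  finally have lim: "(\<lambda>N. prob (A N)) \<longlonglongrightarrow> 1" by (simp add: prob_space)
  then have "eventually (\<lambda>N. prob (A N) > 1 / 2) sequentially" by (rule order_tendstoD) simp
  then obtain N0 where "\<forall>N\<ge>N0. prob (A N) > 1 / 2"
    unfolding eventually_sequentially by blast
  then have N0: "prob (A (N + N0)) > 1 / 2" for N by simp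
  \<comment> \<open>The offset \<open>N0\<close> keeps the conditioning probability above one half
    for every index.\<close>
  let ?U = "\<lambda>N. uniform_measure M (A (N + N0))"
  have le: "(\<Sum>i<n. \<alpha> i * differential_entropy (?U N) (Y i)) \<le> 0" for N
  proof -
    let ?N = "N + N0"
    \<comment> \<open>The density of \<open>X j\<close> is at most \<open>?N\<close> on the cut-off
      set, and conditioning divides by the probability of the event.\<close>
    let ?c = "real ?N / prob (A ?N)"
    have pos: "prob (A ?N) > 0" using N0[of N] by simp
    interpret U: prob_space "?U N"
      using pos by (intro prob_space_uniform_measure) (auto simp: emeasure_eq_measure)
    have ind: "U.indep_vars (\<lambda>_. borel) X {..<m}"
      by (rule indep_vars_uniform_measure[OF indep E A_def pos m])
    have q: "quantized_sum (?U N) m (a i) X (real ?N) ?c" if i: "i < n" for i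
    proof
      show "Gcd (a i ` {..<m}) = 1" using coprime i by simp
      show "continuous_rv (?U N) (\<lambda>\<omega>. \<Sum>j<m. real_of_int (a i j) *\<^sub>R X j \<omega>)"
        using continuous_rv_uniform_measure[OF Y _ A, of i] fin i
        by (simp add: finite_differential_entropy_def Y_def[abs_def])
      show "AE \<omega> in ?U N. norm (X j \<omega>) \<le> real ?N" if "j < m" for j
        using that by (intro AE_uniform_measureI A AE_I2) (auto simp: A_def E_def)
      show "emeasure (?U N) (X j -` B \<inter> space (?U N)) \<le> ennreal ?c * emeasure lborel B"
        if j: "j < m" and B: "B \<in> sets borel" for j B
      proof -
        note [measurable] = f[OF j] E[OF j] B
        have XB: "X j -` (E ?N j \<inter> B) \<inter> space M \<in> sets M"
          by (intro measurable_sets[OF X[OF j]]) measurable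
        have "emeasure M (A ?N \<inter> (X j -` B \<inter> space M)) \<le> emeasure M (X j -` (E ?N j \<inter> B) \<inter> space M)"
          using XB j by (intro emeasure_mono) (auto simp: A_def)
        also have "\<dots> = emeasure (distr M lborel (X j)) (E ?N j \<inter> B)"
          using X[OF j] by (subst emeasure_distr) auto
        also have "\<dots> = (\<integral>\<^sup>+x. ennreal (f j x) * indicator (E ?N j \<inter> B) x \<partial>lborel)"
          using distr_lebesgue_density[OF X[OF j]] cont j by (simp add: emeasure_density f_def[symmetric])
        also have "\<dots> \<le> (\<integral>\<^sup>+x. ennreal (real ?N) * indicator B x \<partial>lborel)"
          by (intro nn_integral_mono) (auto simp: E_def simp del: of_nat_add split: split_indicator intro!: ennreal_leI)
        also have "\<dots> = ennreal (real ?N) * emeasure lborel B" by (simp add: nn_integral_cmult)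
        finally have *: "emeasure M (A ?N \<inter> (X j -` B \<inter> space M)) \<le> ennreal (real ?N) * emeasure lborel B" .
        have "emeasure (?U N) (X j -` B \<inter> space (?U N)) = emeasure M (A ?N \<inter> (X j -` B \<inter> space M)) / emeasure M (A ?N)"
          using measurable_sets[OF X[OF j], of B] by (simp add: A)
        also have "\<dots> \<le> ennreal (real ?N) * emeasure lborel B / emeasure M (A ?N)"
          by (rule divide_right_mono_ennreal[OF *])
        also have "\<dots> = ennreal ?c * emeasure lborel B"
          using pos by (simp add: emeasure_eq_measure divide_ennreal[symmetric] ennreal_divide_times ennreal_times_divide)
        finally show ?thesis .
      qed
    qed (use ind in auto)
    let ?V = "\<lambda>k i \<omega>. \<Sum>j<m. a i j *s lattice_floor (real (Suc k)) (X j \<omega>)"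
    have "(\<lambda>k. \<Sum>i<n. \<alpha> i * (shannon_entropy (?U N) (?V k i) - real CARD('d) * ln (real (Suc k))))
        \<longlonglongrightarrow> (\<Sum>i<n. \<alpha> i * differential_entropy (?U N) (Y i))"
    proof (intro tendsto_intros)
      fix i assume "i \<in> {..<n}"
      then have i: "i < n" by simp
      from quantized_sum.shannon_entropy_tendsto[OF q[OF i]]
      show "(\<lambda>k. shannon_entropy (?U N) (?V k i) - real CARD('d) * ln (real (Suc k))) \<longlonglongrightarrow> differential_entropy (?U N) (Y i)"
        unfolding quantized_sum.V_def[OF q[OF i], abs_def] quantized_sum.Y_def[OF q[OF i], abs_def] Y_def[abs_def] .
    qed
    moreover have "(\<Sum>i<n. \<alpha> i * (shannon_entropy (?U N) (?V k i) - real CARD('d) * ln (real (Suc k)))) \<le> 0" for k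
    proof -
      have "U.indep_vars (\<lambda>_. count_space UNIV) (\<lambda>j. lattice_floor (real (Suc k)) \<circ> X j) {..<m}"
        by (rule U.indep_vars_compose[OF ind]) measurable
      moreover have "finite_shannon_entropy (?U N) (?V k i)" if "i < n" for i
        using quantized_sum.finite_shannon_entropy_V[OF q[OF that], of k]
        unfolding quantized_sum.V_def[OF q[OF that], abs_def] .
      ultimately have "(\<Sum>i<n. \<alpha> i * shannon_entropy (?U N) (?V k i)) \<le> 0"
        by (intro U.shannon_entropy_le_transfer[OF discrete_ineq m]) (simp_all only: o_def)
      \<comment> \<open>The terms \<open>CARD('d) * ln (Suc k)\<close>, which diverge with
        \<open>k\<close>, are the same for every row and cancel since the weights sum to
        zero.\<close>
      moreover have "(\<Sum>i<n. \<alpha> i * (real CARD('d) * ln (real (Suc k)))) = 0"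
        using alpha_sum by (simp add: sum_distrib_right[symmetric])
      ultimately show ?thesis by (simp add: right_diff_distrib sum_subtractf)
    qed
    ultimately show ?thesis by (intro LIMSEQ_le_const2) auto
  qed
  \<comment> \<open>The mesh limit has been taken at a fixed truncation level; only now does the
    truncation level grow.\<close>
  have "(\<lambda>N. \<Sum>i<n. \<alpha> i * differential_entropy (?U N) (Y i)) \<longlonglongrightarrow> (\<Sum>i<n. \<alpha> i * differential_entropy M (Y i))"
  proof (intro tendsto_intros differential_entropy_uniform_measure_tendsto Y A)
    fix i assume "i \<in> {..<n}"
    then show "finite_differential_entropy M (Y i)" using fin by (simp add: Y_def[abs_def])
    show "prob (A (N + N0)) \<ge> 1 / 2" for N using N0[of N] by simp
    show "(\<lambda>N. prob (A (N + N0))) \<longlonglongrightarrow> 1" by (rule LIMSEQ_ignore_initial_segment[OF lim])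
  qed
  then have "(\<Sum>i<n. \<alpha> i * differential_entropy M (Y i)) \<le> 0"
    using le by (intro LIMSEQ_le_const2) auto
  then show ?thesis by (simp add: Y_def[abs_def])
qed simp

end
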